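(* Let $F$ be a field of characteristic zero, $A\subseteq M_n(F)$ a semisimple subalgebra containing the identity, and $\mathcal G$ the group of units of the centralizer of $A$ in $M_n(F)$. Let $X_\alpha=(x_{ij}^{(\alpha)})$, $\alpha=1,\dots,k$, be generic $n\times n$ matrices over the polynomial ring $F[x_{ij}^{(\alpha)}]$, let $R(A,n,k)$ be the ring generated by $X_1,\dots,X_k$ together with $A$, and let $\bar C(A,n,k)$ be the subring of $F[x_{ij}^{(\alpha)}]$ generated by the traces of elements of $R(A,n,k)$. Let $\mathcal G$ act on $F[x_{ij}^{(\alpha)}]$ by letting $g(x_{ij}^{(\alpha)})$ be the $(i,j)$ entry of $gX_\alpha g^{-1}$. Then $F[x_{ij}^{(\alpha)}]^{\mathcal G}=\bar C(A,n,k)$. *)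

theory Defs
  imports "HOL-Analysis.Analysis" "HOL-Library.Poly_Mapping"
begin

text \<open>Commutative polynomial ring F[x_v : v in 'v], monomials = finitely supported
  exponent vectors, polynomials = finitely supported coefficient maps.\<close>
type_synonym ('v, 'a) mpoly = "('v \<Rightarrow>\<^sub>0 nat) \<Rightarrow>\<^sub>0 'a"

definition pconst :: "'a::comm_ring_1 \<Rightarrow> ('v, 'a) mpoly" where
  "pconst c = Poly_Mapping.single 0 c"

definition pvar :: "'v \<Rightarrow> ('v, 'a::comm_ring_1) mpoly" where
  "pvar v = Poly_Mapping.single (Poly_Mapping.single v 1) 1"

text \<open>Substitution (F-algebra endomorphism determined by images of the variables).\<close>
definition psubst :: "('v \<Rightarrow> ('w, 'a::comm_ring_1) mpoly) \<Rightarrow> ('v, 'a) mpoly \<Rightarrow> ('w, 'a) mpoly" where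
  "psubst s p = (\<Sum>mon\<in>Poly_Mapping.keys p. pconst (Poly_Mapping.lookup p mon) * (\<Prod>v\<in>Poly_Mapping.keys (mon :: 'v \<Rightarrow>\<^sub>0 nat). s v ^ Poly_Mapping.lookup mon v))"

text \<open>Scalar multiple of a matrix.\<close>
definition smat :: "'a::semiring_1 \<Rightarrow> 'a^'n^'n \<Rightarrow> 'a^'n^'n" where
  "smat c M = (\<chi> i j. c * M $ i $ j)"

text \<open>F-subalgebra of M_n(F) containing the identity.\<close>
definition unital_subalgebra :: "('a::field^'n^'n) set \<Rightarrow> bool" where
  "unital_subalgebra A \<longleftrightarrow> mat 1 \<in> A \<and>
     (\<forall>x\<in>A. \<forall>y\<in>A. x + y \<in> A \<and> x ** y \<in> A) \<and> (\<forall>c. \<forall>x\<in>A. smat c x \<in> A)"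

text \<open>Two-sided ideal of the algebra A.\<close>
definition alg_ideal :: "('a::field^'n^'n) set \<Rightarrow> ('a^'n^'n) set \<Rightarrow> bool" where
  "alg_ideal A I \<longleftrightarrow> I \<subseteq> A \<and> 0 \<in> I \<and>
     (\<forall>x\<in>I. \<forall>y\<in>I. x + y \<in> I) \<and> (\<forall>c. \<forall>x\<in>I. smat c x \<in> I) \<and>
     (\<forall>a\<in>A. \<forall>x\<in>I. a ** x \<in> I \<and> x ** a \<in> I)"

definition nilpotent_set :: "('a::field^'n^'n) set \<Rightarrow> bool" where
  "nilpotent_set I \<longleftrightarrow> (\<exists>m\<ge>1. \<forall>xs. length xs = m \<and> set xs \<subseteq> I \<longrightarrow> foldr (**) xs (mat 1) = 0)"

text \<open>A finite-dimensional algebra is semisimple iff its (Jacobson) radical, which is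
  its largest nilpotent ideal, is zero, i.e. it has no nonzero nilpotent ideal.\<close>
definition semisimple_alg :: "('a::field^'n^'n) set \<Rightarrow> bool" where
  "semisimple_alg A \<longleftrightarrow> (\<forall>I. alg_ideal A I \<and> nilpotent_set I \<longrightarrow> I = {0})"

text \<open>Units of the centralizer of A in M_n(F).\<close>
definition centralizer_units :: "('a::field^'n^'n) set \<Rightarrow> ('a^'n^'n) set" where
  "centralizer_units A = {g. invertible g \<and> (\<forall>a\<in>A. g ** a = a ** g)}"

text \<open>Variables x_{ij}^{(alpha)} indexed by (alpha, i, j) with alpha :: 'k (k = CARD('k)).\<close>
definition generic :: "'k \<Rightarrow> (('k \<times> 'n \<times> 'n), 'a::comm_ring_1) mpoly ^'n^'n" where
  "generic \<alpha> = (\<chi> i j. pvar (\<alpha>, i, j))"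

definition cmat :: "'a::comm_ring_1^'n^'n \<Rightarrow> ('v, 'a) mpoly ^'n^'n" where
  "cmat a = (\<chi> i j. pconst (a $ i $ j))"

text \<open>R(A,n,k): ring generated by the generic matrices and A.\<close>
inductive_set Rgen :: "('a::field^'n^'n) set \<Rightarrow> ((('k \<times> 'n \<times> 'n), 'a) mpoly ^'n^'n) set"
  for A where
    gen: "generic \<alpha> \<in> Rgen A"
  | alg: "a \<in> A \<Longrightarrow> cmat a \<in> Rgen A"
  | one: "mat 1 \<in> Rgen A"
  | add: "x \<in> Rgen A \<Longrightarrow> y \<in> Rgen A \<Longrightarrow> x + y \<in> Rgen A"
  | neg: "x \<in> Rgen A \<Longrightarrow> - x \<in> Rgen A"
  | mul: "x \<in> Rgen A \<Longrightarrow> y \<in> Rgen A \<Longrightarrow> x ** y \<in> Rgen A"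

text \<open>bar C(A,n,k): subring of F[x] generated by traces of elements of R(A,n,k).\<close>
inductive_set Cbar :: "('a::field^'n^'n) set \<Rightarrow> (('k \<times> 'n \<times> 'n), 'a) mpoly set"
  for A where
    tr: "r \<in> Rgen A \<Longrightarrow> trace r \<in> Cbar A"
  | one: "1 \<in> Cbar A"
  | add: "x \<in> Cbar A \<Longrightarrow> y \<in> Cbar A \<Longrightarrow> x + y \<in> Cbar A"
  | neg: "x \<in> Cbar A \<Longrightarrow> - x \<in> Cbar A"
  | mul: "x \<in> Cbar A \<Longrightarrow> y \<in> Cbar A \<Longrightarrow> x * y \<in> Cbar A"

text \<open>Action of g: x_{ij}^{(alpha)} maps to the (i,j) entry of g X_alpha g^{-1}.\<close>
definition gact :: "'a::field^'n^'n \<Rightarrow> (('k \<times> 'n \<times> 'n), 'a) mpoly \<Rightarrow> (('k \<times> 'n \<times> 'n), 'a) mpoly" where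
  "gact g = psubst (\<lambda>(\<alpha>, i, j). (cmat g ** generic \<alpha> ** cmat (matrix_inv g)) $ i $ j)"

definition invariants :: "('a::field^'n^'n) set \<Rightarrow> (('k \<times> 'n \<times> 'n), 'a) mpoly set" where
  "invariants G = {p. \<forall>g\<in>G. gact g p = p}"

end

theory Submission
  imports Defs "HOL-Combinatorics.Permutations" "HOL-Computational_Algebra.Polynomial"
begin

text \<open>In characteristic zero the coefficients of a polynomial of degree \<open>d\<close> form a unique symmetric
  tensor, so the coefficient tensors of an invariant, viewed as matrices on the \<open>d\<close>-th tensor power
  of the column space, commute with \<open>g \<otimes> \<dots> \<otimes> g\<close> for every unit \<open>g\<close> of the centralizer \<open>B\<close> of \<open>A\<close>.
  Units are dense in \<open>B\<close>, hence by polarization these matrices commute with all symmetrized tensors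
  \<open>\<Sum>\<^sub>\<sigma> b\<^sub>\<sigma>\<^sub>1 \<otimes> \<dots> \<otimes> b\<^sub>\<sigma>\<^sub>d\<close> with \<open>b\<^sub>i\<close> in \<open>B\<close>. The form \<open>tr (x y)\<close>, where \<open>tr\<close> is the regular trace of
  the semisimple algebra \<open>A\<close>, is nondegenerate and yields a separability idempotent \<open>\<Sum> u \<otimes> v\<close>, whose
  averages \<open>\<Sum> u X v\<close> lie in \<open>B\<close>. Taking these for the \<open>b\<^sub>i\<close> gives the double centralizer theorem: the
  coefficient tensors are combinations of the products of a place permutation with some
  \<open>a\<^sub>1 \<otimes> \<dots> \<otimes> a\<^sub>d\<close>, \<open>a\<^sub>i\<close> in \<open>A\<close>. Contracting such a product with generic matrices gives a product of
  traces, one for each cycle of the permutation.\<close>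

section \<open>Coordinates in spaces of functions and matrices\<close>

text \<open>An echelon basis with pivot set \<open>L\<close>, built one coordinate at a time: a new
  coordinate \<open>z\<close> is either determined by the pivots for all of \<open>D\<close> or
  becomes a pivot itself. Having values at the pivots as coordinates keeps the later traces and
  projections explicit over any field.\<close>

lemma subspace_coordinates:
  fixes D :: "('y \<Rightarrow> 'a::field) set"
  assumes "finite Y"
    and zero: "(\<lambda>_. 0) \<in> D"
    and add: "\<And>f g. f \<in> D \<Longrightarrow> g \<in> D \<Longrightarrow> (\<lambda>y. f y + g y) \<in> D"
    and scale: "\<And>a f. f \<in> D \<Longrightarrow> (\<lambda>y. a * f y) \<in> D"
  obtains L c where "L \<subseteq> Y" "\<And>l. l \<in> L \<Longrightarrow> c l \<in> D" "\<And>l. l \<in> L \<Longrightarrow> c l l = 1"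
    "\<And>f y. f \<in> D \<Longrightarrow> y \<in> Y \<Longrightarrow> f y = (\<Sum>l\<in>L. f l * c l y)"
proof -
  have sums: "(\<lambda>y. \<Sum>l\<in>L. a l * c l y) \<in> D"
    if "finite L" "\<And>l. l \<in> L \<Longrightarrow> c l \<in> D" for L and c :: "'y \<Rightarrow> 'y \<Rightarrow> 'a" and a
    using that by (induction L rule: finite_induct) (auto intro: zero scale intro!: add)
  have "\<exists>L c. L \<subseteq> Y \<and> (\<forall>l\<in>L. c l \<in> D \<and> c l l = 1) \<and>
      (\<forall>f\<in>D. \<forall>y\<in>Y. f y = (\<Sum>l\<in>L. f l * c l y))"
    using \<open>finite Y\<close>
  proof (induction Y rule: finite_induct)
    case empty
    show ?case by simp
  next
    case (insert z Y)
    from insert.IH obtain L c where L: "L \<subseteq> Y" and c: "\<And>l. l \<in> L \<Longrightarrow> c l \<in> D \<and> c l l = 1"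
      and rep: "\<And>f y. f \<in> D \<Longrightarrow> y \<in> Y \<Longrightarrow> f y = (\<Sum>l\<in>L. f l * c l y)" by metis
    have fin: "finite L" using L insert.hyps finite_subset by blast
    show ?case
    proof (cases "\<forall>f\<in>D. f z = (\<Sum>l\<in>L. f l * c l z)")
      case True
      with L c rep show ?thesis by (intro exI[of _ L] exI[of _ c]) blast
    next
      case False
      then obtain q where q: "q \<in> D" "q z \<noteq> (\<Sum>l\<in>L. q l * c l z)" by blast
      \<comment> \<open>What the pivots leave of \<open>q\<close>: it vanishes on \<open>Y\<close>
        but not at \<open>z\<close>, so after scaling it serves as the new basis function.\<close>
      define r where "r = (\<lambda>y. q y - (\<Sum>l\<in>L. q l * c l y))"
      have "(\<lambda>y. q y + (- 1) * (\<Sum>l\<in>L. q l * c l y)) \<in> D"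
        using c fin by (intro add q scale sums) auto
      then have rD: "r \<in> D" by (simp add: r_def)
      have rY: "r y = 0" if "y \<in> Y" for y
        using rep[OF q(1) that] by (simp add: r_def)
      have rz: "r z \<noteq> 0" using q by (simp add: r_def)
      define e where "e = (\<lambda>y. inverse (r z) * r y)"
      have eD: "e \<in> D" unfolding e_def by (intro scale rD)
      have eY: "e y = 0" if "y \<in> Y" for y using rY[OF that] by (simp add: e_def)
      have ez: "e z = 1" using rz by (simp add: e_def)
      define c' where "c' = (\<lambda>l. if l = z then e else (\<lambda>y. c l y + (- c l z) * e y))"
      have zL: "z \<notin> L" using L insert.hyps by blast
      have "insert z L \<subseteq> insert z Y" using L by blast
      moreover have "c' l \<in> D \<and> c' l l = 1" if "l \<in> insert z L" for l
      proof (cases "l = z")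
        case False
        then have l: "l \<in> L" "l \<in> Y" using that L by auto
        have "(\<lambda>y. c l y + (- c l z) * e y) \<in> D" using c[OF l(1)] by (intro add scale eD) auto
        then show ?thesis using False c[OF l(1)] eY[OF l(2)] by (simp add: c'_def)
      qed (use eD ez in \<open>simp add: c'_def\<close>)
      moreover have "f y = (\<Sum>l\<in>insert z L. f l * c' l y)" if f: "f \<in> D" and y: "y \<in> insert z Y" for f y
      proof -
        have "(\<Sum>l\<in>L. f l * c' l y) = (\<Sum>l\<in>L. f l * c l y - f l * c l z * e y)"
          using zL by (intro sum.cong) (auto simp: c'_def algebra_simps)
        also have "\<dots> = (\<Sum>l\<in>L. f l * c l y) - (\<Sum>l\<in>L. f l * c l z) * e y"
          by (simp add: sum_subtractf sum_distrib_right)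
        finally have "(\<Sum>l\<in>insert z L. f l * c' l y) =
            f z * e y + ((\<Sum>l\<in>L. f l * c l y) - (\<Sum>l\<in>L. f l * c l z) * e y)"
          using zL fin by (simp add: c'_def)
        moreover have "y \<noteq> z \<Longrightarrow> (\<Sum>l\<in>L. f l * c l y) = f y \<and> e y = 0"
          using y rep[OF f, of y] eY[of y] by auto
        ultimately show ?thesis using ez by (cases "y = z") auto
      qed
      ultimately show ?thesis by (intro exI[of _ "insert z L"] exI[of _ c']) blast
    qed
  qed
  then show thesis using that by metis
qed

section \<open>Arithmetic and subspaces of matrices\<close>

lemma smat_nth [simp]: "smat c M $ i $ j = c * M $ i $ j"
  by (simp add: smat_def)

lemma matrix_mult_nth: "(M ** N) $ i $ j = (\<Sum>k\<in>UNIV. M $ i $ k * N $ k $ j)"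
  by (simp add: matrix_matrix_mult_def)

lemma smat_mult_left: "smat c M ** N = smat c (M ** N)"
  by (simp add: vec_eq_iff matrix_mult_nth sum_distrib_left mult_ac)

lemma smat_mult_right: "M ** smat c N = smat c (M ** N)" for c :: "'a::comm_semiring_1"
  by (simp add: vec_eq_iff matrix_mult_nth sum_distrib_left mult_ac)

lemma matrix_mult_zero [simp]: "M ** 0 = 0" "0 ** M = 0"
  by (simp_all add: vec_eq_iff matrix_mult_nth)

lemma matrix_add_rdistrib: "(M + N) ** P = M ** P + N ** P"
  by (simp add: vec_eq_iff matrix_mult_nth sum.distrib distrib_right)

lemma matrix_diff_distrib:
  fixes M N P :: "'a::ring_1^'n^'n"
  shows "(M - N) ** P = M ** P - N ** P" "P ** (M - N) = P ** M - P ** N"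
  by (simp_all add: vec_eq_iff matrix_mult_nth sum_subtractf left_diff_distrib right_diff_distrib)

lemma matrix_sum_mult_left: "(\<Sum>i\<in>S. f i) ** N = (\<Sum>i\<in>S. f i ** N)"
  by (induction S rule: infinite_finite_induct) (auto simp: matrix_add_rdistrib)

lemma matrix_sum_mult_right: "N ** (\<Sum>i\<in>S. f i) = (\<Sum>i\<in>S. N ** f i)"
  by (induction S rule: infinite_finite_induct) (auto simp: matrix_add_ldistrib)

definition matrix_subspace :: "('a::field^'n^'n) set \<Rightarrow> bool" where
  "matrix_subspace D \<longleftrightarrow> 0 \<in> D \<and> (\<forall>x\<in>D. \<forall>y\<in>D. x + y \<in> D) \<and> (\<forall>c. \<forall>x\<in>D. smat c x \<in> D)"

lemma matrix_subspace_sum: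
  "matrix_subspace D \<Longrightarrow> (\<And>i. i \<in> S \<Longrightarrow> f i \<in> D) \<Longrightarrow> (\<Sum>i\<in>S. f i) \<in> D"
  by (induction S rule: infinite_finite_induct) (auto simp: matrix_subspace_def)

lemma matrix_subspace_diff:
  assumes "matrix_subspace D" "x \<in> D" "y \<in> D" shows "x - y \<in> D"
proof -
  have "x - y = x + smat (- 1) y" by (simp add: vec_eq_iff)
  then show ?thesis using assms unfolding matrix_subspace_def by metis
qed

text \<open>Matrices are read as functions on pairs of indices, so coordinates are matrix entries.
  The pivot entries equal to 1 later make the trace of an idempotent count basis elements.\<close>

lemma matrix_subspace_coordinates:
  fixes D :: "('a::field^'n^'n) set"
  assumes "matrix_subspace D"
  obtains L c where "finite L" "\<And>l. l \<in> L \<Longrightarrow> c l \<in> D" "\<And>l. l \<in> L \<Longrightarrow> c l $ fst l $ snd l = 1"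
    "\<And>M. M \<in> D \<Longrightarrow> M = (\<Sum>l\<in>L. smat (M $ fst l $ snd l) (c l))"
proof -
  let ?e = "\<lambda>M (l::'n \<times> 'n). M $ fst l $ snd l"
  have D: "0 \<in> D" "\<And>x y. x \<in> D \<Longrightarrow> y \<in> D \<Longrightarrow> x + y \<in> D" "\<And>c x. x \<in> D \<Longrightarrow> smat c x \<in> D"
    using assms by (auto simp: matrix_subspace_def)
  obtain L :: "('n \<times> 'n) set" and c where c: "\<And>l. l \<in> L \<Longrightarrow> c l \<in> ?e ` D" "\<And>l. l \<in> L \<Longrightarrow> c l l = 1"
    "\<And>f y. f \<in> ?e ` D \<Longrightarrow> y \<in> UNIV \<Longrightarrow> f y = (\<Sum>l\<in>L. f l * c l y)"
  proof (rule subspace_coordinates[of UNIV "?e ` D"])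
    show "(\<lambda>_. 0) \<in> ?e ` D" using D(1) by force
    show "(\<lambda>y. f y + g y) \<in> ?e ` D" if fg: "f \<in> ?e ` D" "g \<in> ?e ` D" for f g
    proof -
      obtain M N where "M \<in> D" "N \<in> D" "f = ?e M" "g = ?e N" using fg by blast
      then show ?thesis using D(2) by (intro image_eqI[of _ _ "M + N"]) auto
    qed
    show "(\<lambda>y. a * f y) \<in> ?e ` D" if f: "f \<in> ?e ` D" for a f
    proof -
      obtain M where "M \<in> D" "f = ?e M" using f by blast
      then show ?thesis using D(3) by (intro image_eqI[of _ _ "smat a M"]) auto
    qed
  qed auto
  have "\<forall>l\<in>L. \<exists>M. M \<in> D \<and> c l = ?e M" using c(1) by blast
  then obtain d where d: "\<And>l. l \<in> L \<Longrightarrow> d l \<in> D" "\<And>l. l \<in> L \<Longrightarrow> c l = ?e (d l)" by metis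
  have "M = (\<Sum>l\<in>L. smat (?e M l) (d l))" if "M \<in> D" for M
  proof -
    have "M $ i $ j = (\<Sum>l\<in>L. ?e M l * d l $ i $ j)" for i j
    proof -
      have "?e M (i, j) = (\<Sum>l\<in>L. ?e M l * c l (i, j))"
        using that by (intro c(3)) auto
      also have "\<dots> = (\<Sum>l\<in>L. ?e M l * ?e (d l) (i, j))"
        using d(2) by (intro sum.cong) auto
      finally show ?thesis by simp
    qed
    then have "M $ i $ j = (\<Sum>l\<in>L. smat (?e M l) (d l)) $ i $ j" for i j
      unfolding sum_component smat_nth .
    then show ?thesis unfolding vec_eq_iff by blast
  qed
  moreover have "d l $ fst l $ snd l = 1" if "l \<in> L" for l
    using c(2)[OF that] d(2)[OF that] by simp
  ultimately show thesis using that[of L d] d(1) by simp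
qed

text \<open>Matrices are flattened to vectors to have a dimension; at an index of least dimension
  the next inclusion is an equality.\<close>

lemma decreasing_subspaces_stabilize:
  fixes D :: "nat \<Rightarrow> ('a::field^'n^'n) set"
  assumes "\<And>k. matrix_subspace (D k)" and dec: "\<And>k. D (Suc k) \<subseteq> D k"
  obtains k where "D (Suc k) = D k"
proof -
  let ?v = "\<lambda>M :: 'a^'n^'n. (\<chi> l. M $ fst l $ snd l) :: 'a^('n \<times> 'n)"
  have inj: "inj ?v" by (intro injI) (auto simp: vec_eq_iff)
  have sub: "vec.subspace (?v ` D k)" for k
  proof (rule vec.subspaceI)
    have D: "0 \<in> D k" "\<And>x y. x \<in> D k \<Longrightarrow> y \<in> D k \<Longrightarrow> x + y \<in> D k" "\<And>c x. x \<in> D k \<Longrightarrow> smat c x \<in> D k"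
      using assms(1)[of k] by (auto simp: matrix_subspace_def)
    show "0 \<in> ?v ` D k" using D(1) by (intro image_eqI[of _ _ 0]) (auto simp: vec_eq_iff)
    show "x + y \<in> ?v ` D k" if "x \<in> ?v ` D k" "y \<in> ?v ` D k" for x y
    proof -
      obtain M N where "M \<in> D k" "N \<in> D k" "x = ?v M" "y = ?v N" using \<open>x \<in> _\<close> \<open>y \<in> _\<close> by blast
      then show ?thesis using D(2) by (intro image_eqI[of _ _ "M + N"]) (auto simp: vec_eq_iff)
    qed
    show "c *s x \<in> ?v ` D k" if "x \<in> ?v ` D k" for c x
    proof -
      obtain M where "M \<in> D k" "x = ?v M" using \<open>x \<in> _\<close> by blast
      then show ?thesis using D(3) by (intro image_eqI[of _ _ "smat c M"]) (auto simp: vec_eq_iff)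
    qed
  qed
  obtain k where k: "\<And>j. vec.dim (?v ` D k) \<le> vec.dim (?v ` D j)"
    using ex_has_least_nat[of "\<lambda>_. True" 0 "\<lambda>k. vec.dim (?v ` D k)"] by blast
  have "?v ` D (Suc k) = ?v ` D k"
    using dec k by (intro vec.subspace_dim_equal sub) (auto intro: image_mono)
  then have "D (Suc k) = D k" using inj by (simp add: inj_image_eq_iff)
  then show thesis by (rule that)
qed

section \<open>Nilpotent ideals\<close>

lemma unital_subalgebraD:
  assumes "unital_subalgebra A"
  shows "mat 1 \<in> A" "x \<in> A \<Longrightarrow> y \<in> A \<Longrightarrow> x + y \<in> A" "x \<in> A \<Longrightarrow> y \<in> A \<Longrightarrow> x ** y \<in> A"
    "x \<in> A \<Longrightarrow> smat c x \<in> A"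
  using assms by (auto simp: unital_subalgebra_def)

lemma unital_subalgebra_subspace: "unital_subalgebra A \<Longrightarrow> matrix_subspace A"
proof -
  assume A: "unital_subalgebra A"
  have "(0 :: 'a^'n^'n) = smat 0 (mat 1)" by (simp add: vec_eq_iff)
  then have "0 \<in> A" using unital_subalgebraD[OF A] by metis
  then show "matrix_subspace A" using A by (auto simp: matrix_subspace_def unital_subalgebra_def)
qed

section \<open>Powers of a matrix\<close>

primrec matrix_power :: "'a::semiring_1^'n^'n \<Rightarrow> nat \<Rightarrow> 'a^'n^'n" where
  "matrix_power M 0 = mat 1"
| "matrix_power M (Suc k) = M ** matrix_power M k"

lemma matrix_power_commute:
  assumes "w ** y = y ** w" shows "w ** matrix_power y k = matrix_power y k ** w"
proof (induction k)
  case (Suc k)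
  then show ?case using assms by simp (metis matrix_mul_assoc)
qed simp

lemma matrix_power_Suc_right: "matrix_power M (Suc k) = matrix_power M k ** M"
  by (simp add: matrix_power_commute)

lemma matrix_power_mult:
  assumes "x ** y = y ** x" shows "matrix_power (x ** y) k = matrix_power x k ** matrix_power y k"
proof (induction k)
  case (Suc k)
  have "matrix_power (x ** y) (Suc k) = x ** (y ** matrix_power x k) ** matrix_power y k"
    by (simp add: Suc matrix_mul_assoc)
  also have "y ** matrix_power x k = matrix_power x k ** y"
    by (rule matrix_power_commute) (simp add: assms)
  finally show ?case by (simp add: matrix_mul_assoc)
qed simp

lemma matrix_power_mem: "unital_subalgebra A \<Longrightarrow> M \<in> A \<Longrightarrow> matrix_power M k \<in> A"
  by (induction k) (auto simp: unital_subalgebraD)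

lemma matrix_power_geometric_sum:
  "(\<Sum>k<m. matrix_power y k) ** (mat 1 - y) = mat 1 - matrix_power y m" for y :: "'a::ring_1^'n^'n"
proof (induction m)
  case (Suc m)
  have "(\<Sum>k<Suc m. matrix_power y k) ** (mat 1 - y)
      = (\<Sum>k<m. matrix_power y k) ** (mat 1 - y) + matrix_power y m ** (mat 1 - y)"
    by (simp add: matrix_add_rdistrib)
  also have "matrix_power y m ** (mat 1 - y) = matrix_power y m - matrix_power y (Suc m)"
    unfolding matrix_power_Suc_right by (simp add: matrix_diff_distrib)
  finally show ?case using Suc by simp
qed simp

text \<open>Let \<open>C\<close> be the commutative algebra of those elements of \<open>A\<close> that commute with the commutant of
  \<open>y\<close>. The chain of the \<open>y\<^sup>k C\<close> stabilizes, say \<open>y\<^sup>k = y\<^sup>k\<^sup>+\<^sup>1 s\<close> with \<open>s\<close> in \<open>C\<close>; then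
  \<open>(y s)\<^sup>k\<^sup>+\<^sup>1\<close> is the required idempotent.\<close>
lemma power_absorbs_idempotent:
  fixes y :: "'a::field^'n^'n"
  assumes A: "unital_subalgebra A" and y: "y \<in> A"
  obtains m r where "r \<in> A" "(y ** r) ** (y ** r) = y ** r"
    "matrix_power y m = matrix_power y m ** (y ** r)"
proof -
  note cl = unital_subalgebraD[OF A]
  define C where "C = {z \<in> A. \<forall>w. w ** y = y ** w \<longrightarrow> z ** w = w ** z}"
  have C0: "0 \<in> C" using unital_subalgebra_subspace[OF A] by (auto simp: C_def matrix_subspace_def)
  have C1: "mat 1 \<in> C" using cl by (auto simp: C_def)
  have Cadd: "u + v \<in> C" if "u \<in> C" "v \<in> C" for u v
    using that cl by (auto simp: C_def matrix_add_rdistrib matrix_add_ldistrib)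
  have Csc: "smat c u \<in> C" if "u \<in> C" for u c
    using that cl by (auto simp: C_def smat_mult_left smat_mult_right)
  have Cy: "y ** z \<in> C" if z: "z \<in> C" for z
  proof -
    have "y ** z ** w = w ** (y ** z)" if w: "w ** y = y ** w" for w
    proof -
      have "z ** w = w ** z" using z w by (auto simp: C_def)
      then show ?thesis using w by (metis matrix_mul_assoc)
    qed
    then show ?thesis using z y cl by (auto simp: C_def)
  qed
  define D where "D k = (\<lambda>z. matrix_power y k ** z) ` C" for k
  have "matrix_subspace (D k)" for k
    unfolding matrix_subspace_def D_def
  proof (intro conjI ballI allI)
    show "0 \<in> (\<lambda>z. matrix_power y k ** z) ` C" using C0 by force
    show "u + v \<in> (\<lambda>z. matrix_power y k ** z) ` C"
      if uv: "u \<in> (\<lambda>z. matrix_power y k ** z) ` C" "v \<in> (\<lambda>z. matrix_power y k ** z) ` C" for u v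
    proof -
      obtain p q where "p \<in> C" "q \<in> C" "u = matrix_power y k ** p" "v = matrix_power y k ** q"
        using uv by blast
      then show ?thesis
        using Cadd by (intro image_eqI[of _ _ "p + q"]) (auto simp: matrix_add_ldistrib)
    qed
    show "smat c u \<in> (\<lambda>z. matrix_power y k ** z) ` C"
      if u: "u \<in> (\<lambda>z. matrix_power y k ** z) ` C" for u c
    proof -
      obtain p where "p \<in> C" "u = matrix_power y k ** p" using u by blast
      then show ?thesis
        using Csc by (intro image_eqI[of _ _ "smat c p"]) (auto simp: smat_mult_right)
    qed
  qed
  moreover have "D (Suc k) \<subseteq> D k" for k
  proof
    fix z assume "z \<in> D (Suc k)"
    then obtain p where p: "p \<in> C" "z = matrix_power y (Suc k) ** p" by (auto simp: D_def)
    then have "z = matrix_power y k ** (y ** p)"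
      unfolding matrix_power_Suc_right by (simp add: matrix_mul_assoc)
    then show "z \<in> D k" using Cy[OF p(1)] by (auto simp: D_def)
  qed
  ultimately obtain k where k: "D (Suc k) = D k"
    by (rule decreasing_subspaces_stabilize[of D]) auto
  have "matrix_power y k ** mat 1 \<in> D k" unfolding D_def using C1 by (rule imageI)
  then obtain r where r: "r \<in> C" "matrix_power y k = matrix_power y (Suc k) ** r"
    unfolding k[symmetric] by (auto simp: D_def)
  have ry: "r ** y = y ** r" and rA: "r \<in> A" using r(1) by (auto simp: C_def)
  \<comment> \<open>One more than \<open>k\<close>, so that even for \<open>k = 0\<close> a factor
    \<open>y\<close> can be split off from \<open>matrix_power s m\<close>.\<close>
  define m where "m = Suc k"
  define s where "s = y ** r"
  have "matrix_power y m = y ** (matrix_power y (Suc k) ** r)"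
    unfolding m_def using r(2) by simp
  also have "\<dots> = matrix_power y m ** s"
    unfolding matrix_power_Suc_right s_def m_def by (metis matrix_mul_assoc matrix_power.simps(2) matrix_power_Suc_right)
  finally have ys: "matrix_power y m = matrix_power y m ** s" .
  have ysj: "matrix_power y m ** matrix_power s j = matrix_power y m" for j
  proof (induction j)
    case (Suc j)
    then show ?case using ys by (simp add: matrix_mul_assoc)
  qed simp
  \<comment> \<open>Through this factorization the absorption of powers of \<open>s\<close> by
    \<open>matrix_power y m\<close> makes \<open>matrix_power s m\<close> idempotent.\<close>
  have sm: "matrix_power s m = matrix_power r m ** matrix_power y m"
    unfolding s_def ry[symmetric] by (rule matrix_power_mult) (rule ry)
  have idem: "matrix_power s m ** matrix_power s m = matrix_power s m"
    using ysj[of m] sm by (metis matrix_mul_assoc)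
  have e: "matrix_power s m = y ** (r ** matrix_power s k)"
    by (simp add: m_def s_def matrix_mul_assoc)
  show thesis
  proof (rule that[of "r ** matrix_power s k" m])
    show "r ** matrix_power s k \<in> A"
      unfolding s_def by (intro cl matrix_power_mem A y rA)
  qed (use idem ysj[of m] in \<open>simp_all flip: e\<close>)
qed

text \<open>Nakayama's argument: the generators \<open>w i\<close> are eliminated one after the other.\<close>
lemma nakayama_elimination:
  fixes w :: "'i \<Rightarrow> 'a::field^'n^'n"
  assumes A: "unital_subalgebra A" and I: "alg_ideal A I"
    and inv: "\<And>y. y \<in> I \<Longrightarrow> \<exists>y'\<in>A. y' ** (mat 1 - y) = mat 1"
    and "finite L" "\<And>i. i \<in> L \<Longrightarrow> w i = (\<Sum>j\<in>L. x i j ** w j)"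
    "\<And>i j. i \<in> L \<Longrightarrow> j \<in> L \<Longrightarrow> x i j \<in> I" "i \<in> L"
  shows "w i = 0"
  using assms(4-7)
proof (induction L arbitrary: x i rule: finite_induct)
  case (insert l L)
  have IA: "\<And>a x. a \<in> A \<Longrightarrow> x \<in> I \<Longrightarrow> a ** x \<in> I" "\<And>a b. a \<in> I \<Longrightarrow> b \<in> I \<Longrightarrow> a + b \<in> I" "I \<subseteq> A"
    using I by (auto simp: alg_ideal_def)
  \<comment> \<open>The left inverse of \<open>mat 1 - x l l\<close> solves the relation at
    \<open>l\<close> for \<open>w l\<close>. Substituting the solution into the other relations
    keeps their coefficients in the ideal.\<close>
  obtain y' where y': "y' \<in> A" "y' ** (mat 1 - x l l) = mat 1"
    using inv insert.prems(2) by blast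
  have wl: "w l = x l l ** w l + (\<Sum>j\<in>L. x l j ** w j)"
    using insert.prems(1)[of l] insert.hyps by simp
  have "w l = y' ** (mat 1 - x l l) ** w l" by (simp add: y')
  also have "\<dots> = y' ** (w l - x l l ** w l)" by (simp add: matrix_diff_distrib flip: matrix_mul_assoc)
  also have "w l - x l l ** w l = (\<Sum>j\<in>L. x l j ** w j)" using wl by (simp add: algebra_simps)
  finally have wl': "w l = (\<Sum>j\<in>L. (y' ** x l j) ** w j)"
    by (simp add: matrix_sum_mult_right matrix_mul_assoc)
  have L0: "w i = 0" if "i \<in> L" for i
  proof (rule insert.IH)
    show "w i = (\<Sum>j\<in>L. (x i l ** (y' ** x l j) + x i j) ** w j)" if i: "i \<in> L" for i
    proof -
      have "w i = x i l ** w l + (\<Sum>j\<in>L. x i j ** w j)"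
        using insert.prems(1)[of i] insert.hyps i by simp
      also have "x i l ** w l = (\<Sum>j\<in>L. x i l ** (y' ** x l j) ** w j)"
        by (subst wl') (simp add: matrix_sum_mult_right matrix_mul_assoc)
      finally show ?thesis by (simp add: matrix_add_rdistrib sum.distrib)
    qed
    show "x i l ** (y' ** x l j) + x i j \<in> I" if "i \<in> L" "j \<in> L" for i j
      using that insert.prems(2) y' IA by (metis insertCI subsetD)
  qed (rule that)
  have "w l = 0" by (subst wl') (simp add: L0)
  then show ?case using L0 insert.prems by blast
qed simp

text \<open>The product \<open>I W\<close> as a set of finite sums. Scalars are not built in; the
  factor from \<open>I\<close> absorbs them.\<close>

inductive_set matrix_products :: "('a::field^'n^'n) set \<Rightarrow> ('a^'n^'n) set \<Rightarrow> ('a^'n^'n) set"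
  for I W where
    zero: "0 \<in> matrix_products I W"
  | step: "x \<in> I \<Longrightarrow> w \<in> W \<Longrightarrow> z \<in> matrix_products I W \<Longrightarrow> x ** w + z \<in> matrix_products I W"

lemma matrix_products_mono:
  assumes "W \<subseteq> W'" shows "matrix_products I W \<subseteq> matrix_products I W'"
proof
  show "z \<in> matrix_products I W'" if "z \<in> matrix_products I W" for z
    using that assms by induction (auto intro: matrix_products.intros)
qed

lemma matrix_products_subspace:
  fixes I W :: "('a::field^'n^'n) set"
  assumes "\<And>c x. x \<in> I \<Longrightarrow> smat c x \<in> I"
  shows "matrix_subspace (matrix_products I W)"
  unfolding matrix_subspace_def
proof (intro conjI ballI allI)
  show "x + y \<in> matrix_products I W" if "x \<in> matrix_products I W" "y \<in> matrix_products I W" for x y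
    using that by (induction rule: matrix_products.induct)
      (auto simp: add.assoc intro: matrix_products.step)
  show "smat c x \<in> matrix_products I W" if "x \<in> matrix_products I W" for c x
    using that
  proof (induction rule: matrix_products.induct)
    case zero
    have "smat c 0 = (0 :: 'a^'n^'n)" by (simp add: vec_eq_iff)
    then show ?case by (simp add: matrix_products.zero)
  next
    case (step x w z)
    have "smat c (x ** w + z) = smat c x ** w + smat c z"
      by (simp add: vec_eq_iff matrix_mult_nth distrib_left sum_distrib_left mult.assoc)
    with step show ?case by (auto intro: matrix_products.step assms)
  qed
qed (rule matrix_products.zero)

text \<open>For \<open>y\<close> in \<open>I\<close> the idempotent \<open>y ** r\<close> absorbed
  by some power of \<open>y\<close> lies in \<open>I\<close>, hence is zero, so \<open>y\<close> is
  nilpotent and \<open>mat 1 - y\<close> has a left inverse. Nakayama's argument then kills the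
  stable term of the chain of powers of \<open>I\<close> applied to the full matrix algebra.\<close>

lemma idempotent_free_ideal_nilpotent:
  fixes A :: "('a::field^'n^'n) set"
  assumes A: "unital_subalgebra A" and I: "alg_ideal A I"
    and free: "\<And>e. e \<in> I \<Longrightarrow> e ** e = e \<Longrightarrow> e = 0"
  shows "nilpotent_set I"
proof -
  have IA: "\<And>a x. a \<in> A \<Longrightarrow> x \<in> I \<Longrightarrow> a ** x \<in> I \<and> x ** a \<in> I" "\<And>a b. a \<in> I \<Longrightarrow> b \<in> I \<Longrightarrow> a + b \<in> I"
    "I \<subseteq> A" "\<And>c x. x \<in> I \<Longrightarrow> smat c x \<in> I" "0 \<in> I"
    using I by (auto simp: alg_ideal_def)
  have inv: "\<exists>y'\<in>A. y' ** (mat 1 - y) = mat 1" if y: "y \<in> I" for y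
  proof -
    have yA: "y \<in> A" using y IA by blast
    obtain m r where mr: "r \<in> A" "(y ** r) ** (y ** r) = y ** r"
      "matrix_power y m = matrix_power y m ** (y ** r)"
      using power_absorbs_idempotent[OF A yA] by metis
    have "y ** r = 0" using free mr IA y by blast
    then have "matrix_power y m = 0" using mr by simp
    then have "(\<Sum>k<m. matrix_power y k) ** (mat 1 - y) = mat 1"
      by (simp add: matrix_power_geometric_sum)
    moreover have "(\<Sum>k<m. matrix_power y k) \<in> A"
      by (intro matrix_subspace_sum unital_subalgebra_subspace A matrix_power_mem yA)
    ultimately show ?thesis by blast
  qed
  \<comment> \<open>Starting from all matrices puts every product of \<open>k\<close> elements of
    \<open>I\<close> into \<open>J k\<close>.\<close>
  define J where "J k = (matrix_products I ^^ k) UNIV" for k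
  have J_Suc: "J (Suc k) = matrix_products I (J k)" for k by (simp add: J_def)
  have sub: "matrix_subspace (J k)" for k
  proof (cases k)
    case 0
    then show ?thesis by (simp add: J_def matrix_subspace_def)
  next
    case (Suc j)
    then show ?thesis unfolding J_Suc by (simp add: matrix_products_subspace IA(4) J_Suc)
  qed
  have dec: "J (Suc k) \<subseteq> J k" for k
  proof (induction k)
    case 0
    show ?case by (simp add: J_def)
  next
    case (Suc k)
    then show ?case unfolding J_Suc by (metis J_Suc matrix_products_mono)
  qed
  obtain k where k: "J (Suc k) = J k"
    by (rule decreasing_subspaces_stabilize[of J]) (use sub dec in auto)
  obtain L :: "('n \<times> 'n) set" and c where L: "finite L" "\<And>l. l \<in> L \<Longrightarrow> c l \<in> J k"
    and rep: "\<And>M. M \<in> J k \<Longrightarrow> M = (\<Sum>l\<in>L. smat (M $ fst l $ snd l) (c l))"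
    by (rule matrix_subspace_coordinates[OF sub[of k]]) blast
  \<comment> \<open>The elements of \<open>I J\<close> are combinations of the fixed generators
    \<open>c j\<close> with coefficients in \<open>I\<close>. At the stable index this applies to
    the generators themselves and gives the relations for Nakayama's argument.\<close>
  have gen: "\<exists>x. (\<forall>j\<in>L. x j \<in> I) \<and> z = (\<Sum>j\<in>L. x j ** c j)" if "z \<in> matrix_products I (J k)" for z
    using that
  proof (induction rule: matrix_products.induct)
    case zero
    show ?case using IA by (intro exI[of _ "\<lambda>_. 0"]) auto
  next
    case (step x w z)
    then obtain x' where x': "\<forall>j\<in>L. x' j \<in> I" "z = (\<Sum>j\<in>L. x' j ** c j)" by blast
    have "x ** w = x ** (\<Sum>l\<in>L. smat (w $ fst l $ snd l) (c l))" using rep[OF step(2)] by simp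
    also have "\<dots> = (\<Sum>l\<in>L. smat (w $ fst l $ snd l) x ** c l)"
      by (simp add: matrix_sum_mult_right smat_mult_left smat_mult_right)
    finally have "x ** w + z = (\<Sum>l\<in>L. (smat (w $ fst l $ snd l) x + x' l) ** c l)"
      by (simp add: x'(2) matrix_add_rdistrib sum.distrib)
    then show ?case using x' IA step
      by (intro exI[of _ "\<lambda>l. smat (w $ fst l $ snd l) x + x' l"]) auto
  qed
  have "\<forall>i\<in>L. \<exists>x. (\<forall>j\<in>L. x j \<in> I) \<and> c i = (\<Sum>j\<in>L. x j ** c j)"
  proof
    fix i assume "i \<in> L"
    then have "c i \<in> matrix_products I (J k)" using L(2) k J_Suc by auto
    then show "\<exists>x. (\<forall>j\<in>L. x j \<in> I) \<and> c i = (\<Sum>j\<in>L. x j ** c j)" by (rule gen)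
  qed
  then obtain x where x: "\<And>i. i \<in> L \<Longrightarrow> (\<forall>j\<in>L. x i j \<in> I) \<and> c i = (\<Sum>j\<in>L. x i j ** c j)"
    by metis
  have c0: "c i = 0" if "i \<in> L" for i
    by (rule nakayama_elimination[OF A I inv L(1), of c x]) (use x that in auto)
  have "M = 0" if M: "M \<in> J k" for M
  proof -
    have "(\<Sum>l\<in>L. smat (M $ fst l $ snd l) (c l)) = 0"
      by (intro sum.neutral) (auto simp: c0 vec_eq_iff)
    then show ?thesis using rep[OF M] by simp
  qed
  moreover have "foldr (**) xs (mat 1) \<in> J (length xs)" if "set xs \<subseteq> I" for xs
    using that
  proof (induction xs)
    case (Cons x xs)
    then have "x ** foldr (**) xs (mat 1) + 0 \<in> matrix_products I (J (length xs))"
      by (intro matrix_products.intros) auto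
    then show ?case by (simp add: J_Suc)
  qed (simp add: J_def)
  ultimately show ?thesis
    \<comment> \<open>\<open>Suc k\<close> replaces \<open>k\<close> because nilpotency asks for a
      positive exponent.\<close>
    unfolding nilpotent_set_def using k by (intro exI[of _ "Suc k"]) force
qed

section \<open>The separability idempotent of a semisimple algebra\<close>

text \<open>\<open>t a\<close> is the trace of left multiplication by \<open>a\<close> on \<open>A\<close>.\<close>
lemma regular_trace:
  fixes A :: "('a::field_char_0^'n^'n) set"
  assumes A: "unital_subalgebra A"
  obtains t :: "'a^'n^'n \<Rightarrow> 'a" where
    "\<And>x y. t (x + y) = t x + t y" "\<And>c x. t (smat c x) = c * t x"
    "\<And>x y. x \<in> A \<Longrightarrow> y \<in> A \<Longrightarrow> t (x ** y) = t (y ** x)"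
    "\<And>e. e \<in> A \<Longrightarrow> e ** e = e \<Longrightarrow> t e = 0 \<Longrightarrow> e = 0"
    "\<And>(K :: ('n \<times> 'n) set) y z a. \<lbrakk>\<And>k. k \<in> K \<Longrightarrow> y k \<in> A; 
        \<And>x. x \<in> A \<Longrightarrow> x = (\<Sum>k\<in>K. smat (t (z k ** x)) (y k)); a \<in> A\<rbrakk> \<Longrightarrow> (\<Sum>k\<in>K. t (z k ** a ** y k)) = t a"
proof -
  note cl = unital_subalgebraD[OF A]
  let ?e = "\<lambda>M (l::'n \<times> 'n). M $ fst l $ snd l"
  obtain L :: "('n \<times> 'n) set" and c where cA: "\<And>l. l \<in> L \<Longrightarrow> c l \<in> A"
    and rep: "\<And>M. M \<in> A \<Longrightarrow> M = (\<Sum>l\<in>L. smat (?e M l) (c l))"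
    by (rule matrix_subspace_coordinates[OF unital_subalgebra_subspace[OF A]]) blast
  define t where "t a = (\<Sum>l\<in>L. ?e (a ** c l) l)" for a :: "'a^'n^'n"
  have t_add: "t (x + y) = t x + t y" for x y
    by (simp add: t_def matrix_add_rdistrib sum.distrib)
  have t_smat: "t (smat b x) = b * t x" for b x
    by (simp add: t_def smat_mult_left sum_distrib_left)
  have t_0: "t 0 = 0" by (simp add: t_def)
  have t_sum: "t (sum f S) = (\<Sum>i\<in>S. t (f i))" for f and S :: "('n \<times> 'n) set"
    by (induction S rule: infinite_finite_induct) (auto simp: t_0 t_add)
  have t_mult: "t (x ** y) = (\<Sum>l\<in>L. \<Sum>m\<in>L. ?e (y ** c l) m * ?e (x ** c m) l)"
    if "x \<in> A" "y \<in> A" for x y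
  proof -
    have "?e (x ** y ** c l) l = (\<Sum>m\<in>L. ?e (y ** c l) m * ?e (x ** c m) l)" if "l \<in> L" for l
    proof -
      have "x ** y ** c l = x ** (\<Sum>m\<in>L. smat (?e (y ** c l) m) (c m))"
        using rep[of "y ** c l"] cl(3)[OF \<open>y \<in> A\<close> cA[OF that]] by (simp flip: matrix_mul_assoc)
      then show ?thesis by (simp add: matrix_sum_mult_right smat_mult_right)
    qed
    then show ?thesis by (simp add: t_def)
  qed
  have t_comm: "t (x ** y) = t (y ** x)" if "x \<in> A" "y \<in> A" for x y
    unfolding t_mult[OF that] t_mult[OF that(2,1)]
    by (subst sum.swap) (simp add: mult.commute)
  \<comment> \<open>Left multiplication by \<open>e\<close> projects \<open>A\<close> onto
    \<open>e A\<close>, so its trace is the dimension of \<open>e A\<close>, which in characteristic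
    zero vanishes only if \<open>e A\<close> does.\<close>
  have t_idem: "e = 0" if e: "e \<in> A" "e ** e = e" "t e = 0" for e
  proof -
    define D where "D = (\<lambda>z. e ** z) ` A"
    have D_iff: "z \<in> D \<longleftrightarrow> z \<in> A \<and> e ** z = z" for z
      using e cl(3) by (auto simp: D_def matrix_mul_assoc intro: image_eqI[of _ _ z])
    have "matrix_subspace D"
      using unital_subalgebra_subspace[OF A]
      by (auto simp: matrix_subspace_def D_iff matrix_add_ldistrib smat_mult_right)
    then obtain L' :: "('n \<times> 'n) set" and d where fin: "finite L'" and d: "\<And>l. l \<in> L' \<Longrightarrow> d l \<in> D"
      "\<And>l. l \<in> L' \<Longrightarrow> ?e (d l) l = 1"
      and rep': "\<And>M. M \<in> D \<Longrightarrow> M = (\<Sum>l\<in>L'. smat (?e M l) (d l))"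
      by (rule matrix_subspace_coordinates) blast
    \<comment> \<open>The projection is factored through the basis \<open>d\<close> of
      \<open>e A\<close>. Exchanging the two factors does not change the trace and turns the
      composition into the identity of \<open>e A\<close>.\<close>
    have "t e = (\<Sum>l\<in>L. \<Sum>m\<in>L'. ?e (e ** c l) m * ?e (d m) l)"
    proof -
      have "?e (e ** c l) l = (\<Sum>m\<in>L'. ?e (e ** c l) m * ?e (d m) l)" if "l \<in> L" for l
      proof -
        have "e ** c l \<in> D" using cA[OF that] by (auto simp: D_def)
        from arg_cong[OF rep'[OF this], of "\<lambda>M. ?e M l"] show ?thesis by simp
      qed
      then show ?thesis by (simp add: t_def)
    qed
    also have "\<dots> = (\<Sum>m\<in>L'. \<Sum>l\<in>L. ?e (d m) l * ?e (e ** c l) m)"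
      by (subst sum.swap) (simp add: mult.commute)
    also have "\<dots> = (\<Sum>m\<in>L'. 1)"
    proof (rule sum.cong)
      fix m assume m: "m \<in> L'"
      have "d m = e ** (\<Sum>l\<in>L. smat (?e (d m) l) (c l))"
        using rep[of "d m"] d(1)[OF m] by (simp add: D_iff)
      from arg_cong[OF this, of "\<lambda>M. ?e M m"]
      have "?e (d m) m = (\<Sum>l\<in>L. ?e (d m) l * ?e (e ** c l) m)"
        unfolding matrix_sum_mult_right smat_mult_right sum_component smat_nth .
      then show "(\<Sum>l\<in>L. ?e (d m) l * ?e (e ** c l) m) = 1" using d(2)[OF m] by simp
    qed simp
    finally have "L' = {}" using e(3) fin by simp
    moreover have "e \<in> D" using e by (simp add: D_iff)
    ultimately show ?thesis using rep' by simp
  qed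
  \<comment> \<open>The trace computed in a second system: the elements \<open>y k\<close> with
    coordinate functionals \<open>x \<mapsto> t (z k ** x)\<close>. It will be used for systems that
    are dual under the trace form.\<close>
  have t_formula: "(\<Sum>k\<in>K. t (z k ** a ** y k)) = t a"
    if y: "\<And>k. k \<in> K \<Longrightarrow> y k \<in> A" and r: "\<And>x. x \<in> A \<Longrightarrow> x = (\<Sum>k\<in>K. smat (t (z k ** x)) (y k))" and a: "a \<in> A"
    for K :: "('n \<times> 'n) set" and y z a
  proof -
    have "t (z k ** a ** y k) = (\<Sum>l\<in>L. ?e (a ** y k) l * t (z k ** c l))" if "k \<in> K" for k
    proof -
      have "z k ** a ** y k = z k ** (\<Sum>l\<in>L. smat (?e (a ** y k) l) (c l))"
        using rep[of "a ** y k"] cl(3)[OF a y[OF that]] by (simp flip: matrix_mul_assoc)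
      then show ?thesis by (simp add: matrix_sum_mult_right smat_mult_right t_sum t_smat)
    qed
    then have "(\<Sum>k\<in>K. t (z k ** a ** y k)) = (\<Sum>l\<in>L. \<Sum>k\<in>K. t (z k ** c l) * ?e (a ** y k) l)"
      by (simp add: mult.commute) (rule sum.swap)
    also have "\<dots> = (\<Sum>l\<in>L. ?e (a ** c l) l)"
    proof (rule sum.cong)
      fix l assume l: "l \<in> L"
      have "a ** c l = a ** (\<Sum>k\<in>K. smat (t (z k ** c l)) (y k))"
        using r[OF cA[OF l]] by simp
      then show "(\<Sum>k\<in>K. t (z k ** c l) * ?e (a ** y k) l) = ?e (a ** c l) l"
        by (simp add: matrix_sum_mult_right smat_mult_right)
    qed simp
    finally show ?thesis by (simp add: t_def)
  qed
  show thesis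
    by (rule that[of t]) (fact t_add t_smat t_comm t_idem t_formula)+
qed

text \<open>The radical of the form \<open>t (x ** y)\<close> is an ideal without nonzero
  idempotents, so it is nilpotent and, by semisimplicity, zero. Dual systems \<open>u\<close>,
  \<open>v\<close> for the form yield a Casimir element, and sandwiching \<open>X\<close> between
  them projects onto the centralizer of \<open>A\<close>.\<close>

lemma separability_idempotent:
  fixes A :: "('a::field_char_0^'n^'n) set"
  assumes A: "unital_subalgebra A" and ss: "semisimple_alg A"
  obtains L :: "('n \<times> 'n) set" and u v where
    "\<And>l. l \<in> L \<Longrightarrow> u l \<in> A" "\<And>l. l \<in> L \<Longrightarrow> v l \<in> A" "(\<Sum>l\<in>L. u l ** v l) = mat 1"
    "\<And>a X. a \<in> A \<Longrightarrow> a ** (\<Sum>l\<in>L. u l ** X ** v l) = (\<Sum>l\<in>L. u l ** X ** v l) ** a"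
proof -
  note cl = unital_subalgebraD[OF A]
  note sub = unital_subalgebra_subspace[OF A]
  let ?e = "\<lambda>M (l::'n \<times> 'n). M $ fst l $ snd l"
  obtain t :: "'a^'n^'n \<Rightarrow> 'a" where t_add: "\<And>x y. t (x + y) = t x + t y" and t_smat: "\<And>c x. t (smat c x) = c * t x"
    and t_comm: "\<And>x y. x \<in> A \<Longrightarrow> y \<in> A \<Longrightarrow> t (x ** y) = t (y ** x)"
    and t_idem: "\<And>e. e \<in> A \<Longrightarrow> e ** e = e \<Longrightarrow> t e = 0 \<Longrightarrow> e = 0"
    and t_formula: "\<And>(K :: ('n \<times> 'n) set) y z a. \<lbrakk>\<And>k. k \<in> K \<Longrightarrow> y k \<in> A; 
        \<And>x. x \<in> A \<Longrightarrow> x = (\<Sum>k\<in>K. smat (t (z k ** x)) (y k)); a \<in> A\<rbrakk> \<Longrightarrow> (\<Sum>k\<in>K. t (z k ** a ** y k)) = t a"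
    by (rule regular_trace[OF A]) blast
  have t_0: "t 0 = 0" using t_add[of 0 0] by simp
  have t_sum: "t (sum f S) = (\<Sum>i\<in>S. t (f i))" for f and S :: "('n \<times> 'n) set"
    by (induction S rule: infinite_finite_induct) (auto simp: t_0 t_add)
  have t_diff: "t (x - y) = t x - t y" for x y
    using t_add[of "x - y" y] by simp
  define I where "I = {x \<in> A. \<forall>y\<in>A. t (x ** y) = 0}"
  have "alg_ideal A I"
    unfolding alg_ideal_def
  proof (intro conjI ballI allI)
    show "I \<subseteq> A" by (auto simp: I_def)
    show "0 \<in> I" using sub by (auto simp: I_def matrix_subspace_def t_0)
    show "x + y \<in> I" if "x \<in> I" "y \<in> I" for x y
      using that cl by (auto simp: I_def t_add matrix_add_rdistrib)
    show "smat c x \<in> I" if "x \<in> I" for c x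
      using that cl by (auto simp: I_def t_smat smat_mult_left)
    show "x ** a \<in> I" if "a \<in> A" "x \<in> I" for a x
      using that cl by (auto simp: I_def simp flip: matrix_mul_assoc)
    show "a ** x \<in> I" if "a \<in> A" "x \<in> I" for a x
    proof -
      have "t (a ** x ** y) = 0" if "y \<in> A" for y
        using t_comm[of a "x ** y"] \<open>a \<in> A\<close> \<open>x \<in> I\<close> that cl by (auto simp: I_def simp flip: matrix_mul_assoc)
      then show ?thesis using that cl by (auto simp: I_def)
    qed
  qed
  moreover have "nilpotent_set I"
  proof (rule idempotent_free_ideal_nilpotent[OF A \<open>alg_ideal A I\<close>])
    fix e assume e: "e \<in> I" "e ** e = e"
    then have "t e = 0" using cl(1) by (auto simp: I_def)
    then show "e = 0" using e t_idem by (auto simp: I_def)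
  qed
  ultimately have I0: "I = {0}" using ss by (auto simp: semisimple_alg_def)
  have nondeg: "x = y" if "x \<in> A" "y \<in> A" "\<And>z. z \<in> A \<Longrightarrow> t (x ** z) = t (y ** z)" for x y
  proof -
    have "x - y \<in> I"
      using that matrix_subspace_diff[OF sub] by (auto simp: I_def matrix_diff_distrib t_diff)
    then show ?thesis using I0 by simp
  qed
  obtain L :: "('n \<times> 'n) set" and c where fin: "finite L" and cA: "\<And>l. l \<in> L \<Longrightarrow> c l \<in> A"
    and rep: "\<And>M. M \<in> A \<Longrightarrow> M = (\<Sum>l\<in>L. smat (?e M l) (c l))"
    by (rule matrix_subspace_coordinates[OF sub]) blast
  \<comment> \<open>An element is recorded by its pairings with the \<open>c k\<close>. The pivots
    \<open>L'\<close> of the space of these functions select some of the \<open>c k\<close>, and the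
    elements \<open>z l\<close> realizing the pivot basis form the dual system.\<close>
  let ?g = "\<lambda>x k. t (x ** c k)"
  obtain L' q where L': "L' \<subseteq> L" and q: "\<And>l. l \<in> L' \<Longrightarrow> q l \<in> ?g ` A"
    and repq: "\<And>f k. f \<in> ?g ` A \<Longrightarrow> k \<in> L \<Longrightarrow> f k = (\<Sum>l\<in>L'. f l * q l k)"
  proof (rule subspace_coordinates[OF fin, of "?g ` A"])
    show "(\<lambda>_. 0) \<in> ?g ` A"
      using sub by (intro image_eqI[of _ _ 0]) (auto simp: t_0 matrix_subspace_def)
    show "(\<lambda>y. f y + g y) \<in> ?g ` A" if fg: "f \<in> ?g ` A" "g \<in> ?g ` A" for f g
    proof -
      obtain M N where "M \<in> A" "N \<in> A" "f = ?g M" "g = ?g N" using fg by blast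
      then show ?thesis using cl by (intro image_eqI[of _ _ "M + N"]) (auto simp: t_add matrix_add_rdistrib)
    qed
    show "(\<lambda>y. a * f y) \<in> ?g ` A" if f: "f \<in> ?g ` A" for a f
    proof -
      obtain M where "M \<in> A" "f = ?g M" using f by blast
      then show ?thesis using cl by (intro image_eqI[of _ _ "smat a M"]) (auto simp: t_smat smat_mult_left)
    qed
  qed blast
  have "\<forall>l\<in>L'. \<exists>z. z \<in> A \<and> q l = ?g z" using q by blast
  then obtain z where z: "\<And>l. l \<in> L' \<Longrightarrow> z l \<in> A" "\<And>l. l \<in> L' \<Longrightarrow> q l = ?g (z l)" by metis
  have cA': "c l \<in> A" if "l \<in> L'" for l using that L' cA by blast
  have form: "t (x ** y) = (\<Sum>l\<in>L'. t (x ** c l) * t (z l ** y))" if x: "x \<in> A" and y: "y \<in> A" for x y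
  proof -
    have "t (x ** y) = (\<Sum>k\<in>L. ?e y k * t (x ** c k))"
      by (subst rep[OF y]) (simp add: matrix_sum_mult_right smat_mult_right t_sum t_smat)
    also have "\<dots> = (\<Sum>k\<in>L. ?e y k * (\<Sum>l\<in>L'. t (x ** c l) * t (z l ** c k)))"
    proof (rule sum.cong)
      fix k assume k: "k \<in> L"
      have "?g x k = (\<Sum>l\<in>L'. ?g x l * q l k)" using x k by (intro repq) auto
      then show "?e y k * t (x ** c k) = ?e y k * (\<Sum>l\<in>L'. t (x ** c l) * t (z l ** c k))"
        by (simp add: z(2) cong: sum.cong)
    qed simp
    also have "\<dots> = (\<Sum>l\<in>L'. t (x ** c l) * (\<Sum>k\<in>L. ?e y k * t (z l ** c k)))"
      by (simp add: sum_distrib_left mult_ac) (rule sum.swap)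
    also have "\<dots> = (\<Sum>l\<in>L'. t (x ** c l) * t (z l ** (\<Sum>k\<in>L. smat (?e y k) (c k))))"
      by (simp add: matrix_sum_mult_right smat_mult_right t_sum t_smat)
    finally show ?thesis by (simp flip: rep[OF y])
  qed
  have rep1: "x = (\<Sum>l\<in>L'. smat (t (x ** c l)) (z l))" if x: "x \<in> A" for x
  proof (rule nondeg[OF x])
    show "(\<Sum>l\<in>L'. smat (t (x ** c l)) (z l)) \<in> A"
      using z(1) cl by (intro matrix_subspace_sum sub) auto
  qed (simp add: form[OF x] matrix_sum_mult_left smat_mult_left t_sum t_smat)
  have rep2: "y = (\<Sum>l\<in>L'. smat (t (z l ** y)) (c l))" if y: "y \<in> A" for y
  proof (rule nondeg[OF y])
    show "(\<Sum>l\<in>L'. smat (t (z l ** y)) (c l)) \<in> A"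
      using cA' cl by (intro matrix_subspace_sum sub) auto
    fix x assume x: "x \<in> A"
    have "t ((\<Sum>l\<in>L'. smat (t (z l ** y)) (c l)) ** x) = (\<Sum>l\<in>L'. t (z l ** y) * t (x ** c l))"
      using t_comm[OF cA' x] by (simp add: matrix_sum_mult_left smat_mult_left t_sum t_smat)
    then show "t (y ** x) = t ((\<Sum>l\<in>L'. smat (t (z l ** y)) (c l)) ** x)"
      using form[OF x y] t_comm[OF x y] by (simp add: mult.commute)
  qed
  show thesis
  proof (rule that[of L' c z])
    show "(\<Sum>l\<in>L'. c l ** z l) = mat 1"
    proof (rule nondeg)
      show "(\<Sum>l\<in>L'. c l ** z l) \<in> A" using cA' z cl by (intro matrix_subspace_sum sub) auto
      fix a assume a: "a \<in> A"
      \<comment> \<open>By nondegeneracy the identity may be tested against all \<open>a\<close>.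
        Moving \<open>c l\<close> to the end produces the trace of \<open>a\<close> computed in the
        system \<open>c\<close>.\<close>
      have "t (c l ** z l ** a) = t (z l ** a ** c l)" if "l \<in> L'" for l
        using t_comm[OF cA'[OF that] cl(3)[OF z(1)[OF that] a]] by (simp add: matrix_mul_assoc)
      then have "t ((\<Sum>l\<in>L'. c l ** z l) ** a) = (\<Sum>l\<in>L'. t (z l ** a ** c l))"
        by (simp add: matrix_sum_mult_left t_sum)
      also have "\<dots> = t a" by (rule t_formula) (use cA' rep2 a in auto)
      finally show "t ((\<Sum>l\<in>L'. c l ** z l) ** a) = t (mat 1 ** a)" by simp
    qed (rule cl)
    show "a ** (\<Sum>l\<in>L'. c l ** X ** z l) = (\<Sum>l\<in>L'. c l ** X ** z l) ** a" if a: "a \<in> A" for a X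
    proof -
      have "a ** (\<Sum>l\<in>L'. c l ** X ** z l) = (\<Sum>l\<in>L'. (a ** c l) ** X ** z l)"
        by (simp add: matrix_sum_mult_right matrix_mul_assoc)
      \<comment> \<open>The numbers \<open>t (z m ** a ** c l)\<close> are the coefficients both of
        \<open>a ** c l\<close> in the \<open>c m\<close> and of \<open>z m ** a\<close> in the
        \<open>z l\<close>; so \<open>a\<close> passes from one side to the other.\<close>
      also have "\<dots> = (\<Sum>l\<in>L'. (\<Sum>m\<in>L'. smat (t (z m ** (a ** c l))) (c m)) ** X ** z l)"
        using rep2[OF cl(3)[OF a cA']] by (intro sum.cong) simp_all
      also have "\<dots> = (\<Sum>l\<in>L'. \<Sum>m\<in>L'. smat (t (z m ** a ** c l)) (c m ** X ** z l))"
        by (simp add: matrix_sum_mult_left smat_mult_left matrix_mul_assoc)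
      also have "\<dots> = (\<Sum>m\<in>L'. c m ** X ** (\<Sum>l\<in>L'. smat (t (z m ** a ** c l)) (z l)))"
        by (subst sum.swap) (simp add: matrix_sum_mult_right smat_mult_right)
      also have "\<dots> = (\<Sum>m\<in>L'. c m ** X ** (z m ** a))"
        using rep1[OF cl(3)[OF z(1) a]] by (intro sum.cong) simp_all
      also have "\<dots> = (\<Sum>l\<in>L'. c l ** X ** z l) ** a"
        by (simp add: matrix_sum_mult_left matrix_mul_assoc)
      finally show ?thesis .
    qed
  qed (use cA' z in auto)
qed

section \<open>Tensors commuting with tensor powers\<close>

text \<open>Ryser's formula. When the products are expanded over maps \<open>f\<close>, the signed
  sum over all \<open>S\<close> containing the range of \<open>f\<close> is 1 if \<open>f\<close> is
  onto and 0 otherwise. Its purpose is to write symmetrized tensors through pure tensor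
  powers.\<close>

lemma permanent_ryser:
  fixes y :: "nat \<Rightarrow> nat \<Rightarrow> 'a::comm_ring_1"
  shows "(\<Sum>\<sigma> | \<sigma> permutes {..<d}. \<Prod>i<d. y i (\<sigma> i)) =
    (\<Sum>S\<in>Pow {..<d}. (- 1) ^ (d - card S) * (\<Prod>i<d. \<Sum>k\<in>S. y i k))"
proof -
  let ?D = "{..<d}"
  let ?F = "PiE ?D (\<lambda>_. ?D)"
  have fin: "finite ?F" by (intro finite_PiE) auto
  have coeff: "(\<Sum>S | S \<subseteq> ?D \<and> f ` ?D \<subseteq> S. (- 1) ^ (d - card S)) = (if f ` ?D = ?D then 1 else 0 :: 'a)"
    if f: "f \<in> ?F" for f
  proof -
    have fD: "f ` ?D \<subseteq> ?D" using f by auto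
    \<comment> \<open>Complements turn this into the expansion of a power of \<open>1 - 1\<close>
      whose exponent is the number of points missed by \<open>f\<close>.\<close>
    have "(\<Sum>S | S \<subseteq> ?D \<and> f ` ?D \<subseteq> S. (- 1) ^ (d - card S)) =
        (\<Sum>U\<in>Pow (?D - f ` ?D). (- 1) ^ card U :: 'a)"
    proof (rule sum.reindex_bij_witness[of _ "\<lambda>U. ?D - U" "\<lambda>S. ?D - S"])
      fix S assume S: "S \<in> {S. S \<subseteq> ?D \<and> f ` ?D \<subseteq> S}"
      then have "card (?D - S) = d - card S"
        by (subst card_Diff_subset) (auto intro: finite_subset[of _ ?D])
      then show "(- 1) ^ card (?D - S) = (- 1 :: 'a) ^ (d - card S)" by simp
    qed (use fD in auto)
    also have "\<dots> = (\<Sum>U\<in>Pow (?D - f ` ?D). \<Prod>k\<in>U. - 1)"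
      by simp
    also have "\<dots> = (\<Prod>k\<in>?D - f ` ?D. 1 + (- 1))"
      using prod_add[of "?D - f ` ?D" "\<lambda>_. - 1 :: 'a" "\<lambda>_. 1"] by (simp add: add.commute)
    also have "\<dots> = (if f ` ?D = ?D then 1 else 0)"
      using fD by (auto simp: zero_power_eq prod_zero)
    finally show ?thesis .
  qed
  have "(\<Sum>S\<in>Pow ?D. (- 1) ^ (d - card S) * (\<Prod>i<d. \<Sum>k\<in>S. y i k)) =
      (\<Sum>S\<in>Pow ?D. \<Sum>f | f \<in> ?F \<and> f ` ?D \<subseteq> S. (- 1) ^ (d - card S) * (\<Prod>i<d. y i (f i)))"
  proof (rule sum.cong)
    fix S assume S: "S \<in> Pow ?D"
    have "PiE ?D (\<lambda>_. S) = {f \<in> ?F. f ` ?D \<subseteq> S}" using S by (auto simp: PiE_iff extensional_def)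
    then have "(\<Prod>i<d. \<Sum>k\<in>S. y i k) = (\<Sum>f | f \<in> ?F \<and> f ` ?D \<subseteq> S. \<Prod>i<d. y i (f i))"
      using S by (subst prod_sum_PiE) (auto intro: finite_subset)
    then show "(- 1) ^ (d - card S) * (\<Prod>i<d. \<Sum>k\<in>S. y i k) =
        (\<Sum>f | f \<in> ?F \<and> f ` ?D \<subseteq> S. (- 1) ^ (d - card S) * (\<Prod>i<d. y i (f i)))"
      by (simp add: sum_distrib_left)
  qed simp
  also have "\<dots> = (\<Sum>f\<in>?F. \<Sum>S | S \<in> Pow ?D \<and> f ` ?D \<subseteq> S. (- 1) ^ (d - card S) * (\<Prod>i<d. y i (f i)))"
    using fin by (intro sum.swap_restrict) auto
  also have "\<dots> = (\<Sum>f\<in>?F. if f ` ?D = ?D then \<Prod>i<d. y i (f i) else 0)"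
    using coeff by (intro sum.cong) (simp_all flip: sum_distrib_right)
  also have "\<dots> = (\<Sum>f | f \<in> ?F \<and> f ` ?D = ?D. \<Prod>i<d. y i (f i))"
    using fin by (simp add: sum.inter_filter)
  also have "\<dots> = (\<Sum>\<sigma> | \<sigma> permutes ?D. \<Prod>i<d. y i (\<sigma> i))"
  \<comment> \<open>Permutations are the identity outside \<open>?D\<close>, while the maps in
    \<open>?F\<close> are \<open>undefined\<close> there; the witnesses convert between the two
    conventions.\<close>
  proof (rule sum.reindex_bij_witness[of _ "\<lambda>\<sigma>. restrict \<sigma> ?D" "\<lambda>f i. if i < d then f i else i"])
    fix f assume f: "f \<in> {f \<in> ?F. f ` ?D = ?D}"
    then have "inj_on f ?D" by (intro eq_card_imp_inj_on) auto
    then have "bij_betw (\<lambda>i. if i < d then f i else i) ?D ?D"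
      using f by (auto simp: bij_betw_def inj_on_def)
    then show "(\<lambda>i. if i < d then f i else i) \<in> {\<sigma>. \<sigma> permutes ?D}"
      by (auto intro!: bij_imp_permutes split: if_splits)
    show "restrict (\<lambda>i. if i < d then f i else i) ?D = f"
      using f by (auto simp: PiE_iff extensional_def)
  next
    fix \<sigma> assume "\<sigma> \<in> {\<sigma>. \<sigma> permutes ?D}"
    then have \<sigma>: "\<sigma> permutes ?D" by simp
    show "(\<lambda>i. if i < d then restrict \<sigma> ?D i else i) = \<sigma>"
      using permutes_not_in[OF \<sigma>] by auto
    show "restrict \<sigma> ?D \<in> {f \<in> ?F. f ` ?D = ?D}"
      using permutes_image[OF \<sigma>] by auto
  qed simp
  finally show ?thesis by simp
qed

text \<open>Extensional functions give each basis vector of the tensor power exactly one index and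
  keep the index set finite.\<close>

abbreviation multi_indices :: "nat \<Rightarrow> (nat \<Rightarrow> 'n) set" where
  "multi_indices d \<equiv> PiE {..<d} (\<lambda>_. UNIV)"

lemma finite_multi_indices [simp]: "finite (multi_indices d :: (nat \<Rightarrow> 'n::finite) set)"
  by (intro finite_PiE) auto

text \<open>The matrix of the composition of \<open>a 0 \<otimes> \<dots> \<otimes> a (d - 1)\<close> with the place permutation \<open>\<sigma>\<close>.\<close>
definition tensor :: "nat \<Rightarrow> (nat \<Rightarrow> nat) \<Rightarrow> (nat \<Rightarrow> 'a::comm_semiring_1^'n^'n) \<Rightarrow> (nat \<Rightarrow> 'n) \<Rightarrow> (nat \<Rightarrow> 'n) \<Rightarrow> 'a" where
  "tensor d \<sigma> a I K = (\<Prod>i<d. a i $ I i $ K (\<sigma> i))"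

text \<open>Reindexing the first product by \<open>inv \<sigma>\<close> brings together the two
  entries containing \<open>J i\<close>; the sum over \<open>J\<close> then splits into one matrix
  product for each place.\<close>

lemma tensor_mult:
  fixes a b :: "nat \<Rightarrow> 'a::comm_semiring_1^'n^'n"
  assumes \<sigma>: "\<sigma> permutes {..<d}"
  shows "(\<Sum>J\<in>multi_indices d. tensor d \<sigma> a I J * tensor d \<tau> b J K) =
    tensor d (\<tau> \<circ> \<sigma>) (\<lambda>i. a i ** b (\<sigma> i)) I K"
proof -
  have "tensor d \<sigma> a I J * tensor d \<tau> b J K =
      (\<Prod>i<d. b i $ J i $ K (\<tau> i) * a (inv \<sigma> i) $ I (inv \<sigma> i) $ J i)" for J
  proof -
    have "(\<Prod>i<d. a i $ I i $ J (\<sigma> i)) = (\<Prod>i<d. a (inv \<sigma> i) $ I (inv \<sigma> i) $ J (\<sigma> (inv \<sigma> i)))"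
      using prod.permute[OF permutes_inv[OF \<sigma>], of "\<lambda>i. a i $ I i $ J (\<sigma> i)"] by (simp add: o_def)
    then show ?thesis using \<sigma> by (simp add: tensor_def prod.distrib permutes_inverses mult.commute)
  qed
  then have "(\<Sum>J\<in>multi_indices d. tensor d \<sigma> a I J * tensor d \<tau> b J K) =
      (\<Prod>i<d. \<Sum>j\<in>UNIV. b i $ j $ K (\<tau> i) * a (inv \<sigma> i) $ I (inv \<sigma> i) $ j)"
    by (simp add: prod_sum_PiE)
  also have "\<dots> = (\<Prod>i<d. (a (inv \<sigma> i) ** b i) $ I (inv \<sigma> i) $ K (\<tau> i))"
    by (simp add: matrix_mult_nth mult.commute)
  also have "\<dots> = (\<Prod>i<d. (a (inv \<sigma> (\<sigma> i)) ** b (\<sigma> i)) $ I (inv \<sigma> (\<sigma> i)) $ K (\<tau> (\<sigma> i)))"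
    using prod.permute[OF \<sigma>, of "\<lambda>i. (a (inv \<sigma> i) ** b i) $ I (inv \<sigma> i) $ K (\<tau> i)"] by (simp add: o_def)
  finally show ?thesis using \<sigma> by (simp add: tensor_def permutes_inverses)
qed

lemma tensor_one:
  assumes "I \<in> multi_indices d" "K \<in> multi_indices d"
  shows "tensor d id (\<lambda>_. mat 1) I K = (if I = K then 1 else 0)"
proof (cases "I = K")
  case False
  then obtain i where "i < d" "I i \<noteq> K i" using assms by (metis PiE_ext lessThan_iff)
  then show ?thesis using False by (auto simp: tensor_def mat_def prod_zero_iff intro!: prod_zero)
qed (simp add: tensor_def mat_def)

section \<open>Commutation with tensor powers\<close>

definition commutes_with :: "nat \<Rightarrow> ((nat \<Rightarrow> 'n) \<Rightarrow> (nat \<Rightarrow> 'n) \<Rightarrow> 'a::comm_ring_1) \<Rightarrow> ((nat \<Rightarrow> 'n) \<Rightarrow> (nat \<Rightarrow> 'n) \<Rightarrow> 'a) \<Rightarrow> bool" where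
  "commutes_with d T U \<longleftrightarrow> (\<forall>I\<in>multi_indices d. \<forall>K\<in>multi_indices d.
     (\<Sum>M\<in>multi_indices d. T I M * U M K) = (\<Sum>M\<in>multi_indices d. U I M * T M K))"

text \<open>Units are Zariski dense in a line \<open>b + t\<close>: both sides are polynomials in \<open>t\<close>, and
  \<open>b + t\<close> is singular only at the finitely many roots of the characteristic polynomial.\<close>
lemma commutes_with_power_of_units:
  fixes b :: "'a::field_char_0^'n^'n"
  assumes T: "\<And>t. invertible (b + mat t) \<Longrightarrow> commutes_with d T (tensor d id (\<lambda>_. b + mat t))"
  shows "commutes_with d T (tensor d id (\<lambda>_. b))"
  unfolding commutes_with_def
proof (intro ballI)
  fix I K :: "nat \<Rightarrow> 'n" assume IK: "I \<in> multi_indices d" "K \<in> multi_indices d"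
  \<comment> \<open>\<open>B\<close> is the line \<open>b + t\<close> over the polynomial ring, and
    \<open>p\<close> is one entry of the commutator as a polynomial in \<open>t\<close>.\<close>
  define B :: "'a poly^'n^'n" where "B = (\<chi> i j. [: b $ i $ j, if i = j then 1 else 0 :])"
  define p where "p = (\<Sum>M\<in>multi_indices d. [:T I M:] * tensor d id (\<lambda>_. B) M K) -
    (\<Sum>M\<in>multi_indices d. tensor d id (\<lambda>_. B) I M * [:T M K:])"
  have Bt: "poly (B $ i $ j) t = (b + mat t) $ i $ j" for i j t
    by (auto simp: B_def mat_def)
  have pt: "poly p t = (\<Sum>M\<in>multi_indices d. T I M * tensor d id (\<lambda>_. b + mat t) M K) -
    (\<Sum>M\<in>multi_indices d. tensor d id (\<lambda>_. b + mat t) I M * T M K)" for t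
    by (simp add: p_def poly_sum poly_prod tensor_def Bt mult.commute)
  have detB: "poly (det B) t = det (b + mat t)" for t
    by (simp add: det_def poly_sum poly_prod Bt)
  have det_nz: "det B \<noteq> 0"
  proof
    assume "det B = 0"
    \<comment> \<open>The reversed determinant: if \<open>det B\<close> were zero,
      \<open>det C\<close> would vanish at every nonzero \<open>t\<close>, yet its value at 0 is
      1.\<close>
    define C :: "'a poly^'n^'n" where "C = (\<chi> i j. [: if i = j then 1 else 0, b $ i $ j :])"
    have Ct: "poly (det C) t = det (mat 1 + smat t b)" for t
      by (auto simp: C_def det_def poly_sum poly_prod mat_def intro!: sum.cong prod.cong)
    have "poly (det C) t = 0" if "t \<noteq> 0" for t
    proof -
      have "mat 1 + smat t b = smat t (b + mat (inverse t))"
        using that by (auto simp: vec_eq_iff mat_def field_simps)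
      moreover have "det (smat t (b + mat (inverse t))) = t ^ CARD('n) * det (b + mat (inverse t))"
        by (simp add: det_def prod.distrib sum_distrib_left mult_ac)
      ultimately show ?thesis using \<open>det B = 0\<close> Ct[of t] detB[of "inverse t"] by simp
    qed
    then have "UNIV - {0} \<subseteq> {t. poly (det C) t = 0}" by auto
    moreover have "infinite (UNIV - {0::'a})" by (simp add: infinite_UNIV_char_0)
    ultimately have "det C = 0" using poly_roots_finite finite_subset by blast
    moreover have "smat 0 b = 0" by (simp add: vec_eq_iff)
    ultimately show False using Ct[of 0] by simp
  qed
  have "{t. poly (det B) t \<noteq> 0} \<subseteq> {t. poly p t = 0}"
  proof clarify
    fix t assume "poly (det B) t \<noteq> 0"
    then have "invertible (b + mat t)" by (simp add: detB invertible_det_nz)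
    from T[OF this] IK show "poly p t = 0" unfolding pt commutes_with_def by simp
  qed
  moreover have "infinite {t. poly (det B) t \<noteq> 0}"
  proof
    assume "finite {t. poly (det B) t \<noteq> 0}"
    then have "finite ({t. poly (det B) t \<noteq> 0} \<union> {t. poly (det B) t = 0})"
      using poly_roots_finite[OF det_nz] by simp
    moreover have "{t. poly (det B) t \<noteq> 0} \<union> {t. poly (det B) t = 0} = UNIV" by auto
    ultimately show False using infinite_UNIV_char_0[where 'a='a] by simp
  qed
  ultimately have "p = 0" using poly_roots_finite finite_subset by blast
  then have "poly p 0 = 0" by simp
  then show "(\<Sum>M\<in>multi_indices d. T I M * tensor d id (\<lambda>_. b) M K) =
      (\<Sum>M\<in>multi_indices d. tensor d id (\<lambda>_. b) I M * T M K)"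
    unfolding pt by simp
qed

text \<open>Polarization: by Ryser's formula, applied entrywise, the symmetrized tensor is a signed
  sum of tensor powers of subset sums, and commuting with \<open>T\<close> is a linear
  condition.\<close>

lemma commutes_with_symmetrization:
  fixes b :: "nat \<Rightarrow> 'a::comm_ring_1^'n^'n"
  assumes "\<And>S. S \<subseteq> {..<d} \<Longrightarrow> commutes_with d T (tensor d id (\<lambda>_. \<Sum>k\<in>S. b k))"
  shows "commutes_with d T (\<lambda>I K. \<Sum>\<sigma> | \<sigma> permutes {..<d}. tensor d id (b \<circ> \<sigma>) I K)"
proof -
  define U where "U S = tensor d id (\<lambda>_. \<Sum>k\<in>S. b k)" for S
  define s :: "nat set \<Rightarrow> 'a" where "s S = (- 1) ^ (d - card S)" for S
  have eq: "(\<Sum>\<sigma> | \<sigma> permutes {..<d}. tensor d id (b \<circ> \<sigma>) I K) = (\<Sum>S\<in>Pow {..<d}. s S * U S I K)" for I K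
    using permanent_ryser[of "\<lambda>i k. b k $ I i $ K i" d]
    by (simp add: tensor_def U_def s_def)
  have U: "(\<Sum>M\<in>multi_indices d. T I M * U S M K) = (\<Sum>M\<in>multi_indices d. U S I M * T M K)"
    if "S \<in> Pow {..<d}" "I \<in> multi_indices d" "K \<in> multi_indices d" for S I K
    using assms[of S] that by (simp add: commutes_with_def U_def)
  show ?thesis
    unfolding commutes_with_def eq
  proof (intro ballI)
    fix I K :: "nat \<Rightarrow> 'n" assume IK: "I \<in> multi_indices d" "K \<in> multi_indices d"
    have "(\<Sum>M\<in>multi_indices d. T I M * (\<Sum>S\<in>Pow {..<d}. s S * U S M K)) =
        (\<Sum>S\<in>Pow {..<d}. s S * (\<Sum>M\<in>multi_indices d. T I M * U S M K))"
      by (simp add: sum_distrib_left mult_ac) (rule sum.swap)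
    also have "\<dots> = (\<Sum>S\<in>Pow {..<d}. s S * (\<Sum>M\<in>multi_indices d. U S I M * T M K))"
      using U IK by (intro sum.cong) simp_all
    also have "\<dots> = (\<Sum>M\<in>multi_indices d. (\<Sum>S\<in>Pow {..<d}. s S * U S I M) * T M K)"
      by (simp add: sum_distrib_left sum_distrib_right mult_ac) (rule sum.swap)
    finally show "(\<Sum>M\<in>multi_indices d. T I M * (\<Sum>S\<in>Pow {..<d}. s S * U S M K)) =
      (\<Sum>M\<in>multi_indices d. (\<Sum>S\<in>Pow {..<d}. s S * U S I M) * T M K)" .
  qed
qed

section \<open>The double centralizer theorem\<close>

text \<open>For a unital subalgebra \<open>A\<close> this is the algebra generated by the place
  permutations and the elementary tensors over \<open>A\<close>; it is closed under products by
  \<open>tensor_mult\<close>.\<close>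

inductive_set tensor_span :: "('a::comm_ring_1^'n^'n) set \<Rightarrow> nat \<Rightarrow> ((nat \<Rightarrow> 'n) \<Rightarrow> (nat \<Rightarrow> 'n) \<Rightarrow> 'a) set"
  for A d where
    zero: "(\<lambda>_ _. 0) \<in> tensor_span A d"
  | step: "\<sigma> permutes {..<d} \<Longrightarrow> (\<And>i. i < d \<Longrightarrow> a i \<in> A) \<Longrightarrow> f \<in> tensor_span A d \<Longrightarrow>
      (\<lambda>I K. c * tensor d \<sigma> a I K + f I K) \<in> tensor_span A d"

lemma tensor_span_tensor:
  assumes "\<sigma> permutes {..<d}" "\<And>i. i < d \<Longrightarrow> a i \<in> A"
  shows "tensor d \<sigma> a \<in> tensor_span A d"
  using tensor_span.step[OF assms tensor_span.zero, where c=1] by simp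

lemma tensor_span_add:
  assumes "f \<in> tensor_span A d" "g \<in> tensor_span A d"
  shows "(\<lambda>I K. f I K + g I K) \<in> tensor_span A d"
  using assms
proof induction
  case (step \<sigma> a f c)
  from tensor_span.step[OF step(1,2) step(4)[OF step(5)], where c=c]
  show ?case by (simp add: add.assoc)
qed simp

lemma tensor_span_scale:
  assumes "f \<in> tensor_span A d"
  shows "(\<lambda>I K. b * f I K) \<in> tensor_span A d"
  using assms
proof induction
  case zero
  show ?case by (simp add: tensor_span.zero)
next
  case (step \<sigma> a f c)
  from tensor_span.step[OF step(1,2,4), where c="b * c"]
  show ?case by (simp add: distrib_left mult.assoc)
qed

lemma tensor_span_sum:
  assumes "\<And>x. x \<in> S \<Longrightarrow> f x \<in> tensor_span A d"
  shows "(\<lambda>I K. \<Sum>x\<in>S. f x I K) \<in> tensor_span A d"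
  using assms
  by (induction S rule: infinite_finite_induct) (auto intro: tensor_span.zero tensor_span_add)

lemma tensor_span_mult_left:
  assumes A: "unital_subalgebra A" and "\<sigma> permutes {..<d}" "\<And>i. i < d \<Longrightarrow> a i \<in> A" "f \<in> tensor_span A d"
  shows "(\<lambda>I K. \<Sum>J\<in>multi_indices d. tensor d \<sigma> a I J * f J K) \<in> tensor_span A d"
  using assms(4)
proof induction
  case zero
  show ?case by (simp add: tensor_span.zero)
next
  case (step \<tau> b f c)
  have "\<sigma> i < d" if "i < d" for i using permutes_in_image[OF assms(2), of i] that by simp
  then have mem: "a i ** b (\<sigma> i) \<in> A" if "i < d" for i
    using that step(2) assms(3) unital_subalgebraD(3)[OF A] by blast
  have "(\<lambda>I K. \<Sum>J\<in>multi_indices d. tensor d \<sigma> a I J * (c * tensor d \<tau> b J K + f J K)) =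
      (\<lambda>I K. c * tensor d (\<tau> \<circ> \<sigma>) (\<lambda>i. a i ** b (\<sigma> i)) I K + (\<Sum>J\<in>multi_indices d. tensor d \<sigma> a I J * f J K))"
    unfolding tensor_mult[OF assms(2), symmetric]
    by (simp add: distrib_left sum.distrib sum_distrib_left mult_ac)
  then show ?case
    using tensor_span.step[OF permutes_compose[OF assms(2) step(1)] mem step(4), where c=c] by simp
qed

text \<open>The sum over all choices \<open>J\<close> is the expansion of the tensor power of
  \<open>\<Sum>l\<in>L. u l ** v l\<close>.\<close>

lemma tensor_id_one_sum:
  assumes "(\<Sum>l\<in>L. u l ** v l) = mat 1" "finite L"
    and "I \<in> multi_indices d" "K \<in> multi_indices d"
  shows "(\<Sum>J\<in>PiE {..<d} (\<lambda>_. L). tensor d id (\<lambda>i. u (J i) ** v (J i)) I K) = (if I = K then 1 else 0)"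
proof -
  have "(\<Sum>J\<in>PiE {..<d} (\<lambda>_. L). tensor d id (\<lambda>i. u (J i) ** v (J i)) I K) =
      (\<Prod>i<d. \<Sum>l\<in>L. (u l ** v l) $ I i $ K i)"
    using assms(2) by (simp add: tensor_def prod_sum_PiE)
  also have "\<dots> = tensor d id (\<lambda>_. \<Sum>l\<in>L. u l ** v l) I K" by (simp add: tensor_def)
  finally show ?thesis using assms by (simp add: tensor_one)
qed

text \<open>The double centralizer theorem for \<open>A\<^sup>\<otimes>\<^sup>d\<close> and the place permutations. Averaging elementary
  tensors over the separability idempotent \<open>u \<otimes> v\<close> yields tensors commuting with \<open>T\<close>; read as
  an identity in \<open>End \<otimes> End\<close>, its second factor is projected onto \<open>tensor_span A d\<close> by
  coordinates, and multiplying both factors leaves \<open>d! T\<close> on one side.\<close>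
lemma tensor_double_centralizer:
  fixes A :: "('a::field_char_0^'n^'n) set" and T :: "(nat \<Rightarrow> 'n) \<Rightarrow> (nat \<Rightarrow> 'n) \<Rightarrow> 'a"
  assumes A: "unital_subalgebra A" and ss: "semisimple_alg A"
    and T: "\<And>g. g \<in> centralizer_units A \<Longrightarrow> commutes_with d T (tensor d id (\<lambda>_. g))"
  obtains q where "q \<in> tensor_span A d"
    "\<And>I K. I \<in> multi_indices d \<Longrightarrow> K \<in> multi_indices d \<Longrightarrow> T I K = q I K"
proof -
  let ?N = "multi_indices d :: (nat \<Rightarrow> 'n) set"
  obtain L :: "('n \<times> 'n) set" and u v where uv: "\<And>l. l \<in> L \<Longrightarrow> u l \<in> A" "\<And>l. l \<in> L \<Longrightarrow> v l \<in> A"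
    and one: "(\<Sum>l\<in>L. u l ** v l) = mat 1"
    and inv: "\<And>a X. a \<in> A \<Longrightarrow> a ** (\<Sum>l\<in>L. u l ** X ** v l) = (\<Sum>l\<in>L. u l ** X ** v l) ** a"
    by (rule separability_idempotent[OF A ss]) blast
  have finL: "finite L" by simp
  define X where "X = {\<sigma>. \<sigma> permutes {..<d}} \<times> PiE {..<d} (\<lambda>_. L)"
  have finX: "finite X" unfolding X_def by (intro finite_SigmaI finite_PiE finite_permutations) auto
  \<comment> \<open>For \<open>k = (\<sigma>, J)\<close> the two permutations in \<open>P k\<close>
    and \<open>Q k\<close> cancel, so that the product of \<open>P k\<close> and \<open>Q k\<close>
    is the elementary tensor of the matrices \<open>u (J i) ** v (J i)\<close>.\<close>
  define P where "P = (\<lambda>(\<sigma>, J). tensor d \<sigma> (\<lambda>i. u (J i)))"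
  define Q where "Q = (\<lambda>(\<sigma>, J). tensor d (inv \<sigma>) (\<lambda>i. v (J (inv \<sigma> i))))"
  have Qspan: "Q k \<in> tensor_span A d" if k: "k \<in> X" for k
  proof -
    obtain \<sigma> J where k': "k = (\<sigma>, J)" "\<sigma> permutes {..<d}" "J \<in> PiE {..<d} (\<lambda>_. L)"
      using k by (auto simp: X_def)
    have "inv \<sigma> i < d" if "i < d" for i
      using permutes_in_image[OF permutes_inv[OF k'(2)], of i] that by simp
    then show ?thesis
      unfolding k'(1) Q_def prod.case using k' uv
      by (intro tensor_span_tensor permutes_inv) (auto simp: PiE_iff)
  qed
  have Pspan: "(\<lambda>I K. \<Sum>J\<in>?N. P k I J * f J K) \<in> tensor_span A d"
    if k: "k \<in> X" and f: "f \<in> tensor_span A d" for k f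
  proof -
    obtain \<sigma> J where k': "k = (\<sigma>, J)" "\<sigma> permutes {..<d}" "J \<in> PiE {..<d} (\<lambda>_. L)"
      using k by (auto simp: X_def)
    then show ?thesis
      unfolding k'(1) P_def prod.case using k' uv
      by (intro tensor_span_mult_left A f) (auto simp: PiE_iff)
  qed
  \<comment> \<open>This is the identity
    \<open>\<Sum> T P k \<otimes> Q k = \<Sum> P k \<otimes> Q k T\<close>. Its entries come from
    averaging the matrix units \<open>E i\<close> at position \<open>(r i, s i)\<close> into the
    centralizer and symmetrizing the result.\<close>
  have casimir: "(\<Sum>M\<in>?N. T I M * (\<Sum>k\<in>X. P k M r * Q k s K)) = (\<Sum>M\<in>?N. (\<Sum>k\<in>X. P k I r * Q k s M) * T M K)"
    if N: "I \<in> ?N" "K \<in> ?N" "r \<in> ?N" "s \<in> ?N" for I K r s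
  proof -
    define E :: "nat \<Rightarrow> 'a^'n^'n" where "E i = (\<chi> p q. if p = r i \<and> q = s i then 1 else 0)" for i
    define b where "b i = (\<Sum>l\<in>L. u l ** E i ** v l)" for i
    have b_nth: "b i $ p $ q = (\<Sum>l\<in>L. u l $ p $ r i * v l $ s i $ q)" for i p q
    proof -
      have "(u l ** E i) $ p $ k = (if k = s i then u l $ p $ r i else 0)" for l k
      proof -
        have "(u l ** E i) $ p $ k = (\<Sum>j\<in>UNIV. if j = r i then (if k = s i then u l $ p $ r i else 0) else 0)"
          unfolding matrix_mult_nth by (intro sum.cong) (auto simp: E_def)
        then show ?thesis by simp
      qed
      then have "(u l ** E i ** v l) $ p $ q = (\<Sum>k\<in>UNIV. if k = s i then u l $ p $ r i * v l $ s i $ q else 0)" for l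
        unfolding matrix_mult_nth[of "u l ** E i"] by (intro sum.cong) auto
      then show ?thesis by (simp add: b_def)
    qed
    have bA: "a ** b i = b i ** a" if "a \<in> A" for a i
      unfolding b_def by (rule inv[OF that])
    have "commutes_with d T (\<lambda>I K. \<Sum>\<sigma> | \<sigma> permutes {..<d}. tensor d id (b \<circ> \<sigma>) I K)"
    proof (rule commutes_with_symmetrization, rule commutes_with_power_of_units, rule T)
      fix S t assume "invertible ((\<Sum>k\<in>S. b k) + mat t)"
      moreover have "mat t ** a = a ** mat t" for a :: "'a^'n^'n"
      proof -
        have "(mat t :: 'a^'n^'n) = smat t (mat 1)" by (simp add: vec_eq_iff mat_def)
        then show ?thesis by (simp add: smat_mult_left smat_mult_right)
      qed
      ultimately show "(\<Sum>k\<in>S. b k) + mat t \<in> centralizer_units A"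
        using bA by (auto simp: centralizer_units_def matrix_add_rdistrib matrix_add_ldistrib
          matrix_sum_mult_left matrix_sum_mult_right)
    qed
    moreover have "(\<Sum>\<sigma> | \<sigma> permutes {..<d}. tensor d id (b \<circ> \<sigma>) I K) = (\<Sum>k\<in>X. P k I r * Q k s K)" for I K
    proof -
      have "tensor d id (b \<circ> \<sigma>) I K = (\<Sum>J\<in>PiE {..<d} (\<lambda>_. L). P (\<sigma>, J) I r * Q (\<sigma>, J) s K)"
        if \<sigma>: "\<sigma> permutes {..<d}" for \<sigma>
      proof -
        have "tensor d id (b \<circ> \<sigma>) I K = (\<Sum>J\<in>PiE {..<d} (\<lambda>_. L).
            (\<Prod>i<d. u (J i) $ I i $ r (\<sigma> i)) * (\<Prod>i<d. v (J i) $ s (\<sigma> i) $ K i))"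
          by (simp add: tensor_def b_nth prod_sum_PiE prod.distrib)
        also have "\<dots> = (\<Sum>J\<in>PiE {..<d} (\<lambda>_. L). P (\<sigma>, J) I r * Q (\<sigma>, J) s K)"
        proof (rule sum.cong)
          fix J
          have "(\<Prod>i<d. v (J i) $ s (\<sigma> i) $ K i) = (\<Prod>i<d. v (J (inv \<sigma> i)) $ s i $ K (inv \<sigma> i))"
            using prod.permute[OF permutes_inv[OF \<sigma>], of "\<lambda>i. v (J i) $ s (\<sigma> i) $ K i"]
              permutes_inverses[OF \<sigma>] by (simp add: o_def)
          then show "(\<Prod>i<d. u (J i) $ I i $ r (\<sigma> i)) * (\<Prod>i<d. v (J i) $ s (\<sigma> i) $ K i)
              = P (\<sigma>, J) I r * Q (\<sigma>, J) s K"
            by (simp add: P_def Q_def tensor_def)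
        qed simp
        finally show ?thesis .
      qed
      then show ?thesis by (simp add: X_def sum.cartesian_product')
    qed
    ultimately show ?thesis using N by (simp add: commutes_with_def)
  qed
  let ?c = "\<lambda>f (z :: (nat \<Rightarrow> 'n) \<times> (nat \<Rightarrow> 'n)). f (fst z) (snd z) :: 'a"
  obtain Z c where Z: "Z \<subseteq> ?N \<times> ?N" and c: "\<And>l. l \<in> Z \<Longrightarrow> c l \<in> ?c ` tensor_span A d"
    and rep: "\<And>f y. f \<in> ?c ` tensor_span A d \<Longrightarrow> y \<in> ?N \<times> ?N \<Longrightarrow> f y = (\<Sum>l\<in>Z. f l * c l y)"
  proof (rule subspace_coordinates[of "?N \<times> ?N" "?c ` tensor_span A d"])
    show "(\<lambda>_. 0) \<in> ?c ` tensor_span A d" using tensor_span.zero by (rule image_eqI[rotated]) simp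
    show "(\<lambda>y. f y + g y) \<in> ?c ` tensor_span A d" if fg: "f \<in> ?c ` tensor_span A d" "g \<in> ?c ` tensor_span A d" for f g
    proof -
      obtain p q where "p \<in> tensor_span A d" "q \<in> tensor_span A d" "f = ?c p" "g = ?c q" using fg by blast
      then show ?thesis using tensor_span_add by (intro image_eqI[of _ _ "\<lambda>I K. p I K + q I K"]) auto
    qed
    show "(\<lambda>y. a * f y) \<in> ?c ` tensor_span A d" if f: "f \<in> ?c ` tensor_span A d" for a f
    proof -
      obtain p where "p \<in> tensor_span A d" "f = ?c p" using f by blast
      then show ?thesis using tensor_span_scale by (intro image_eqI[of _ _ "\<lambda>I K. a * p I K"]) auto
    qed
  qed (simp, blast)
  have "\<forall>l\<in>Z. \<exists>h. h \<in> tensor_span A d \<and> c l = ?c h" using c by blast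
  then obtain h where h: "\<And>l. l \<in> Z \<Longrightarrow> h l \<in> tensor_span A d" "\<And>l. l \<in> Z \<Longrightarrow> c l = ?c (h l)" by metis
  \<comment> \<open>\<open>\<Sum>l\<in>Z. ?c f l * h l\<close> projects linearly onto the span and
    fixes every \<open>Q k\<close>. Without it, multiplying both factors of \<open>casimir\<close>
    would only give \<open>fact d * T\<close> on either side.\<close>
  have proj: "f s K = (\<Sum>l\<in>Z. ?c f l * h l s K)" if f: "f \<in> tensor_span A d" and N: "s \<in> ?N" "K \<in> ?N" for f s K
  proof -
    have "?c f (s, K) = (\<Sum>l\<in>Z. ?c f l * c l (s, K))" using f N by (intro rep) auto
    also have "\<dots> = (\<Sum>l\<in>Z. ?c f l * ?c (h l) (s, K))" using h(2) by (intro sum.cong) auto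
    finally show ?thesis by simp
  qed
  \<comment> \<open>Each of the \<open>fact d\<close> permutations contributes one copy of the
    identity.\<close>
  have fact: "(\<Sum>k\<in>X. \<Sum>r\<in>?N. P k M r * Q k r K) = (if M = K then fact d else 0)"
    if N: "M \<in> ?N" "K \<in> ?N" for M K
  proof -
    have "(\<Sum>r\<in>?N. P (\<sigma>, J) M r * Q (\<sigma>, J) r K) = tensor d id (\<lambda>i. u (J i) ** v (J i)) M K"
      if \<sigma>: "\<sigma> permutes {..<d}" for \<sigma> J
      by (simp add: P_def Q_def tensor_mult[OF \<sigma>] permutes_inverses[OF \<sigma>] permutes_inv_o[OF \<sigma>])
    then have "(\<Sum>k\<in>X. \<Sum>r\<in>?N. P k M r * Q k r K) =
        (\<Sum>\<sigma> | \<sigma> permutes {..<d}. \<Sum>J\<in>PiE {..<d} (\<lambda>_. L). tensor d id (\<lambda>i. u (J i) ** v (J i)) M K)"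
      by (simp add: X_def sum.cartesian_product')
    then show ?thesis
      using tensor_id_one_sum[OF one finL N] card_permutations[of "{..<d}" d] by simp
  qed
  \<comment> \<open>The coordinates of the projection of the product \<open>Q k T\<close>.\<close>
  define w where "w k l = (\<Sum>M\<in>?N. Q k (fst l) M * T M (snd l))" for k l
  have key: "fact d * T I K = (\<Sum>l\<in>Z. \<Sum>k\<in>X. w k l * (\<Sum>r\<in>?N. P k I r * h l r K))"
    if N: "I \<in> ?N" "K \<in> ?N" for I K
  proof -
    have "fact d * T I K = (\<Sum>M\<in>?N. T I M * (if M = K then fact d else 0))"
      using N by (simp add: if_distrib cong: if_cong)
    also have "\<dots> = (\<Sum>M\<in>?N. T I M * (\<Sum>k\<in>X. \<Sum>r\<in>?N. P k M r * Q k r K))"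
      using fact N by (intro sum.cong) auto
    also have "\<dots> = (\<Sum>M\<in>?N. T I M * (\<Sum>k\<in>X. \<Sum>r\<in>?N. P k M r * (\<Sum>l\<in>Z. ?c (Q k) l * h l r K)))"
      using proj[OF Qspan] N by (intro sum.cong arg_cong2[where f="(*)"] refl) auto
    also have "\<dots> = (\<Sum>M\<in>?N. \<Sum>k\<in>X. \<Sum>r\<in>?N. \<Sum>l\<in>Z. h l r K * (T I M * (P k M r * ?c (Q k) l)))"
      by (simp add: sum_distrib_left mult_ac)
    also have "\<dots> = (\<Sum>M\<in>?N. \<Sum>r\<in>?N. \<Sum>k\<in>X. \<Sum>l\<in>Z. h l r K * (T I M * (P k M r * ?c (Q k) l)))"
      by (intro sum.cong refl sum.swap)
    also have "\<dots> = (\<Sum>r\<in>?N. \<Sum>M\<in>?N. \<Sum>l\<in>Z. \<Sum>k\<in>X. h l r K * (T I M * (P k M r * ?c (Q k) l)))"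
      by (subst sum.swap) (intro sum.cong refl sum.swap)
    also have "\<dots> = (\<Sum>r\<in>?N. \<Sum>l\<in>Z. \<Sum>M\<in>?N. \<Sum>k\<in>X. h l r K * (T I M * (P k M r * ?c (Q k) l)))"
      by (intro sum.cong refl sum.swap)
    also have "\<dots> = (\<Sum>r\<in>?N. \<Sum>l\<in>Z. h l r K * (\<Sum>M\<in>?N. T I M * (\<Sum>k\<in>X. P k M r * Q k (fst l) (snd l))))"
      by (simp add: sum_distrib_left)
    also have "\<dots> = (\<Sum>r\<in>?N. \<Sum>l\<in>Z. h l r K * (\<Sum>M\<in>?N. (\<Sum>k\<in>X. P k I r * Q k (fst l) M) * T M (snd l)))"
    proof (rule sum.cong[OF refl], rule sum.cong[OF refl])
      fix r l assume r: "r \<in> ?N" and l: "l \<in> Z"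
      have "fst l \<in> ?N" "snd l \<in> ?N" using subsetD[OF Z l] by (simp_all only: mem_Times_iff)
      from casimir[OF N(1) this(2) r this(1)] show "h l r K * (\<Sum>M\<in>?N. T I M * (\<Sum>k\<in>X. P k M r * Q k (fst l) (snd l))) =
          h l r K * (\<Sum>M\<in>?N. (\<Sum>k\<in>X. P k I r * Q k (fst l) M) * T M (snd l))"
        by (rule arg_cong)
    qed
    also have "\<dots> = (\<Sum>r\<in>?N. \<Sum>l\<in>Z. h l r K * (\<Sum>k\<in>X. P k I r * w k l))"
    proof -
      have "(\<Sum>M\<in>?N. (\<Sum>k\<in>X. P k I r * Q k (fst l) M) * T M (snd l)) = (\<Sum>k\<in>X. P k I r * w k l)" for r l
        by (simp add: w_def sum_distrib_left sum_distrib_right mult.assoc) (rule sum.swap)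
      then show ?thesis by simp
    qed
    also have "\<dots> = (\<Sum>l\<in>Z. \<Sum>r\<in>?N. \<Sum>k\<in>X. w k l * (P k I r * h l r K))"
      by (subst sum.swap) (simp add: sum_distrib_left mult_ac)
    also have "\<dots> = (\<Sum>l\<in>Z. \<Sum>k\<in>X. w k l * (\<Sum>r\<in>?N. P k I r * h l r K))"
      unfolding sum_distrib_left by (intro sum.cong refl sum.swap)
    finally show ?thesis .
  qed
  define q where "q = (\<lambda>I K. inverse (fact d) * (\<Sum>l\<in>Z. \<Sum>k\<in>X. w k l * (\<Sum>r\<in>?N. P k I r * h l r K)))"
  show thesis
  proof (rule that[of q])
    show "q \<in> tensor_span A d"
      unfolding q_def
      by (intro tensor_span_scale tensor_span_sum Pspan h)
    show "T I K = q I K" if "I \<in> ?N" "K \<in> ?N" for I K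
      unfolding q_def key[OF that, symmetric] by simp
  qed
qed

section \<open>Traces and the group action\<close>

lemma pconst_add: "pconst (a + b) = pconst a + pconst b"
  by (simp add: pconst_def single_add)

lemma pconst_zero [simp]: "pconst 0 = 0"
  by (simp add: pconst_def)

lemma pconst_one [simp]: "pconst 1 = 1"
  by (simp add: pconst_def)

lemma pconst_mult: "pconst (a * b) = pconst a * pconst b"
  by (simp add: pconst_def mult_single)

lemma pconst_sum: "pconst (\<Sum>x\<in>S. f x) = (\<Sum>x\<in>S. pconst (f x))"
  by (induction S rule: infinite_finite_induct) (auto simp: pconst_add)

lemma pconst_prod: "pconst (\<Prod>x\<in>S. f x) = (\<Prod>x\<in>S. pconst (f x))"
  by (induction S rule: infinite_finite_induct) (auto simp: pconst_mult)

lemma poly_mapping_expansion: "p = (\<Sum>k\<in>Poly_Mapping.keys p. Poly_Mapping.single k (Poly_Mapping.lookup p k))"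
  by (rule poly_mapping_eqI) (auto simp: lookup_sum lookup_single when_def in_keys_iff sum.delta')

text \<open>A common finite set of monomials for several polynomials makes substitution visibly
  additive.\<close>

lemma psubst_superset:
  assumes "finite S" "Poly_Mapping.keys p \<subseteq> S"
  shows "psubst s p = (\<Sum>m\<in>S. pconst (Poly_Mapping.lookup p m) *
    (\<Prod>v\<in>Poly_Mapping.keys m. s v ^ Poly_Mapping.lookup m v))"
  unfolding psubst_def using assms
  by (intro sum.mono_neutral_left) (auto simp: in_keys_iff)

lemma psubst_add: "psubst s (p + q) = psubst s p + psubst s q"
proof -
  let ?S = "Poly_Mapping.keys p \<union> Poly_Mapping.keys q"
  have "Poly_Mapping.keys (p + q) \<subseteq> ?S" by (rule keys_add)
  then show ?thesis
    by (simp add: psubst_superset[of ?S] lookup_add pconst_add distrib_right sum.distrib)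
qed

lemma psubst_zero [simp]: "psubst s 0 = 0"
  by (simp add: psubst_def)

lemma psubst_sum: "psubst s (\<Sum>x\<in>S. f x) = (\<Sum>x\<in>S. psubst s (f x))"
  by (induction S rule: infinite_finite_induct) (auto simp: psubst_add)

lemma psubst_uminus: "psubst s (- p) = - psubst s p"
proof -
  have "psubst s (- p) + psubst s p = 0" unfolding psubst_add[symmetric] by simp
  then show ?thesis by (simp add: add_eq_0_iff2)
qed

lemma psubst_single: "psubst s (Poly_Mapping.single m c) =
    pconst c * (\<Prod>v\<in>Poly_Mapping.keys m. s v ^ Poly_Mapping.lookup m v)"
  by (simp add: psubst_superset[of "{m}"])

lemma psubst_mult: "psubst s (p * q) = psubst s p * psubst s q"
proof -
  let ?m = "\<lambda>m. \<Prod>v\<in>Poly_Mapping.keys m. s v ^ Poly_Mapping.lookup m v"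
  have m_superset: "?m m = (\<Prod>v\<in>S. s v ^ Poly_Mapping.lookup m v)"
    if "finite S" "Poly_Mapping.keys m \<subseteq> S" for m S
    using that by (intro prod.mono_neutral_left) (auto simp: in_keys_iff)
  have m_add: "?m (a + b) = ?m a * ?m b" for a b
  proof -
    let ?S = "Poly_Mapping.keys a \<union> Poly_Mapping.keys b"
    have "Poly_Mapping.keys (a + b) \<subseteq> ?S" by (rule keys_add)
    then have "?m (a + b) = (\<Prod>v\<in>?S. s v ^ Poly_Mapping.lookup (a + b) v)" by (intro m_superset) auto
    moreover have "?m a = (\<Prod>v\<in>?S. s v ^ Poly_Mapping.lookup a v)"
      "?m b = (\<Prod>v\<in>?S. s v ^ Poly_Mapping.lookup b v)" by (auto intro: m_superset)
    ultimately show ?thesis by (simp add: lookup_add power_add prod.distrib)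
  qed
  have single: "psubst s (Poly_Mapping.single a c * Poly_Mapping.single b c') =
      psubst s (Poly_Mapping.single a c) * psubst s (Poly_Mapping.single b c')" for a b c c'
    by (simp add: mult_single psubst_single m_add pconst_mult mult_ac)
  have "psubst s (p * q) = psubst s
      ((\<Sum>a\<in>Poly_Mapping.keys p. Poly_Mapping.single a (Poly_Mapping.lookup p a)) *
       (\<Sum>b\<in>Poly_Mapping.keys q. Poly_Mapping.single b (Poly_Mapping.lookup q b)))"
    by (simp flip: poly_mapping_expansion)
  also have "\<dots> = psubst s (\<Sum>a\<in>Poly_Mapping.keys p. Poly_Mapping.single a (Poly_Mapping.lookup p a)) *
      psubst s (\<Sum>b\<in>Poly_Mapping.keys q. Poly_Mapping.single b (Poly_Mapping.lookup q b))"
    by (simp add: sum_product psubst_sum single)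
  finally show ?thesis by (simp flip: poly_mapping_expansion)
qed

lemma psubst_pconst [simp]: "psubst s (pconst c) = pconst c"
  unfolding pconst_def by (simp add: psubst_single) (simp add: pconst_def)

lemma psubst_one [simp]: "psubst s 1 = 1"
  using psubst_pconst[of s 1] by simp

lemma psubst_prod: "psubst s (\<Prod>x\<in>S. f x) = (\<Prod>x\<in>S. psubst s (f x))"
  by (induction S rule: infinite_finite_induct) (auto simp: psubst_mult)

lemma psubst_pvar [simp]: "psubst s (pvar v) = s v"
  by (simp add: pvar_def psubst_single)

section \<open>Conjugation and invariance of traces\<close>

lemma cmat_mult: "cmat (a ** b) = cmat a ** cmat b"
  by (simp add: cmat_def vec_eq_iff matrix_mult_nth pconst_sum pconst_mult)

lemma cmat_one [simp]: "cmat (mat 1) = mat 1"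
  by (simp add: cmat_def mat_def vec_eq_iff)

lemma invertible_matrix_inv:
  assumes "invertible g" shows "g ** matrix_inv g = mat 1" "matrix_inv g ** g = mat 1"
  using assms someI_ex[of "\<lambda>h. g ** h = mat 1 \<and> h ** g = mat 1"]
  unfolding invertible_def matrix_inv_def by auto

text \<open>Entrywise substitution and conjugation by \<open>g\<close> are both ring homomorphisms,
  so they need to agree only on generators. On constant matrices from \<open>A\<close> both are
  trivial because \<open>g\<close> centralizes \<open>A\<close>.\<close>

lemma gact_Rgen:
  fixes A :: "('a::field^'n^'n) set" and r :: "('k \<times> 'n \<times> 'n, 'a) mpoly^'n^'n"
  assumes g: "g \<in> centralizer_units A" and r: "r \<in> Rgen A"
  shows "(\<chi> i j. gact g (r $ i $ j)) = cmat g ** r ** cmat (matrix_inv g)"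
  using r
proof (induction rule: Rgen.induct)
  case (gen \<alpha>)
  show ?case by (simp add: vec_eq_iff gact_def generic_def)
next
  case (alg a)
  have inv: "g ** matrix_inv g = mat 1" and comm: "g ** a = a ** g"
    using g alg by (auto simp: centralizer_units_def invertible_matrix_inv)
  have "cmat g ** cmat a ** cmat (matrix_inv g) = (cmat :: _ \<Rightarrow> ('k \<times> 'n \<times> 'n, 'a) mpoly^'n^'n) (a ** (g ** matrix_inv g))"
    by (simp add: comm matrix_mul_assoc flip: cmat_mult)
  moreover have "(\<chi> i j. gact g (cmat a $ i $ j)) = (cmat a :: ('k \<times> 'n \<times> 'n, 'a) mpoly^'n^'n)"
    by (simp add: vec_eq_iff gact_def cmat_def)
  ultimately show ?case by (simp add: inv)
next
  case one
  have inv: "g ** matrix_inv g = mat 1"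
    using g by (auto simp: centralizer_units_def invertible_matrix_inv)
  then have "cmat g ** mat 1 ** cmat (matrix_inv g) = (mat 1 :: ('k \<times> 'n \<times> 'n, 'a) mpoly^'n^'n)"
    by (simp flip: cmat_mult)
  moreover have "(\<chi> i j. gact g (mat 1 $ i $ j)) = (mat 1 :: ('k \<times> 'n \<times> 'n, 'a) mpoly^'n^'n)"
    by (simp add: vec_eq_iff gact_def mat_def)
  ultimately show ?case by simp
next
  case (add x y)
  then show ?case
    by (simp add: vec_eq_iff gact_def psubst_add matrix_add_ldistrib matrix_add_rdistrib)
next
  case (neg x)
  have "cmat g ** (- x) ** cmat (matrix_inv g) = - (cmat g ** x ** cmat (matrix_inv g))"
    by (simp add: vec_eq_iff matrix_mult_nth sum_negf)
  with neg show ?case by (simp add: vec_eq_iff gact_def psubst_uminus)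
next
  case (mul x y)
  have inv: "matrix_inv g ** g = mat 1"
    using g by (auto simp: centralizer_units_def invertible_matrix_inv)
  have "(\<chi> i j. gact g ((x ** y) $ i $ j)) = (\<chi> i j. gact g (x $ i $ j)) ** (\<chi> i j. gact g (y $ i $ j))"
    by (simp add: vec_eq_iff gact_def matrix_mult_nth psubst_sum psubst_mult)
  also have "\<dots> = cmat g ** x ** cmat (matrix_inv g ** g) ** y ** cmat (matrix_inv g)"
    by (simp add: mul.IH cmat_mult matrix_mul_assoc)
  finally show ?case by (simp add: inv matrix_mul_assoc)
qed

lemma Cbar_subset_invariants:
  fixes A :: "('a::field^'n^'n) set"
  shows "(Cbar A :: ('k \<times> 'n \<times> 'n, 'a) mpoly set) \<subseteq> invariants (centralizer_units A)"
proof
  fix p :: "('k \<times> 'n \<times> 'n, 'a) mpoly" assume "p \<in> Cbar A"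
  then show "p \<in> invariants (centralizer_units A)"
  proof (induction rule: Cbar.induct)
    case (tr r)
    have "gact g (trace r) = trace r" if g: "g \<in> centralizer_units A" for g
    proof -
      have inv: "matrix_inv g ** g = mat 1"
        using g by (auto simp: centralizer_units_def invertible_matrix_inv)
      have "gact g (trace r) = trace (\<chi> i j. gact g (r $ i $ j))"
        by (simp add: trace_def gact_def psubst_sum)
      also have "\<dots> = trace (cmat (matrix_inv g) ** (cmat g ** r))"
        unfolding gact_Rgen[OF g tr] by (rule trace_mul_sym)
      also have "\<dots> = trace r" by (simp add: matrix_mul_assoc inv flip: cmat_mult)
      finally show ?thesis .
    qed
    then show ?case by (simp add: invariants_def)
  qed (auto simp: invariants_def gact_def psubst_add psubst_uminus psubst_mult)
qed

section \<open>Constants and contractions in the trace ring\<close>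

lemma Cbar_zero: "0 \<in> Cbar A"
  using Cbar.add[OF Cbar.one Cbar.neg[OF Cbar.one], of A] by simp

lemma Cbar_sum: "(\<And>x. x \<in> S \<Longrightarrow> f x \<in> Cbar A) \<Longrightarrow> (\<Sum>x\<in>S. f x) \<in> Cbar A"
  by (induction S rule: infinite_finite_induct) (auto intro: Cbar_zero Cbar.add)

text \<open>\<open>Cbar\<close> is generated merely as a ring. Constants are recovered as traces of
  scalar matrices in \<open>A\<close>, after division by the matrix size.\<close>

lemma Cbar_pconst:
  fixes A :: "('a::field_char_0^'n^'n) set"
  assumes "unital_subalgebra A" shows "(pconst c :: ('k \<times> 'n \<times> 'n, 'a) mpoly) \<in> Cbar A"
proof -
  have "smat (c / of_nat CARD('n)) (mat 1) \<in> A" using assms by (auto simp: unital_subalgebra_def)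
  then have "(trace (cmat (smat (c / of_nat CARD('n)) (mat 1 :: 'a^'n^'n))) :: ('k \<times> 'n \<times> 'n, 'a) mpoly) \<in> Cbar A" by (intro Cbar.tr Rgen.alg)
  moreover have "(trace (cmat (smat (c / of_nat CARD('n)) (mat 1 :: 'a^'n^'n))) :: ('k \<times> 'n \<times> 'n, 'a) mpoly) =
      (\<Sum>i\<in>(UNIV :: 'n set). pconst (c / of_nat CARD('n)))"
    by (simp add: trace_def cmat_def mat_def)
  moreover have "\<dots> = pconst (\<Sum>i\<in>(UNIV :: 'n set). c / of_nat CARD('n))"
    by (rule pconst_sum[symmetric])
  ultimately show ?thesis by simp
qed

lemma sum_PiE_insert:
  fixes f :: "('i \<Rightarrow> 'n::finite) \<Rightarrow> 'b::comm_monoid_add"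
  assumes "finite S" "t \<notin> S"
  shows "(\<Sum>I\<in>PiE (insert t S) (\<lambda>_. UNIV). f I) = (\<Sum>I\<in>PiE S (\<lambda>_. UNIV). \<Sum>y\<in>UNIV. f (I(t := y)))"
proof -
  have "(\<Sum>I\<in>PiE (insert t S) (\<lambda>_. UNIV). f I) = (\<Sum>(y, I)\<in>UNIV \<times> PiE S (\<lambda>_. UNIV). f (I(t := y)))"
    unfolding PiE_insert_eq
    by (subst sum.reindex) (use inj_combinator[OF assms(2), of "\<lambda>_. UNIV"] in \<open>auto simp: case_prod_unfold\<close>)
  also have "\<dots> = (\<Sum>y\<in>UNIV. \<Sum>I\<in>PiE S (\<lambda>_. UNIV). f (I(t := y)))"
    by (simp add: sum.cartesian_product)
  finally show ?thesis by (simp add: sum.swap[of _ "PiE S (\<lambda>_. UNIV)"])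
qed

text \<open>The sum is a product of traces, one for each cycle of \<open>\<sigma>\<close>. Removing the point \<open>t\<close> from
  its cycle replaces the factors at \<open>s = \<sigma>\<^sup>-\<^sup>1 t\<close> and \<open>t\<close> by the matrix product \<open>Z s ** Z t\<close>.\<close>
lemma cycle_contraction_in_Cbar:
  assumes "finite S" "\<sigma> permutes S" "\<And>m. m \<in> S \<Longrightarrow> Z m \<in> Rgen A"
  shows "(\<Sum>I\<in>PiE S (\<lambda>_. UNIV). \<Prod>m\<in>S. Z m $ I m $ I (\<sigma> m)) \<in> Cbar A"
  using assms
proof (induction S arbitrary: \<sigma> Z rule: finite_induct)
  case empty
  then show ?case by (simp add: Cbar.one)
next
  case (insert t S)
  note \<sigma> = insert.prems(1)
  show ?case
  proof (cases "\<sigma> t = t")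
    case True
    have \<sigma>S: "\<sigma> permutes S"
      by (rule permutes_superset[OF \<sigma>]) (use True in auto)
    \<comment> \<open>A fixed point splits off a diagonal entry of \<open>Z t\<close>, whose sum
      over \<open>y\<close> is a trace.\<close>
    have "(\<Prod>m\<in>insert t S. Z m $ (I(t := y)) m $ (I(t := y)) (\<sigma> m)) =
        Z t $ y $ y * (\<Prod>m\<in>S. Z m $ I m $ I (\<sigma> m))" for I :: "'a \<Rightarrow> 'c" and y
    proof -
      have "\<sigma> m \<noteq> t" if "m \<in> S" for m using that permutes_in_image[OF \<sigma>S, of m] insert.hyps by auto
      then have "(\<Prod>m\<in>S. Z m $ (I(t := y)) m $ (I(t := y)) (\<sigma> m)) = (\<Prod>m\<in>S. Z m $ I m $ I (\<sigma> m))"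
        using insert.hyps by (intro prod.cong) auto
      then show ?thesis using insert.hyps True by simp
    qed
    then have "(\<Sum>I\<in>PiE (insert t S) (\<lambda>_. UNIV). \<Prod>m\<in>insert t S. Z m $ I m $ I (\<sigma> m)) =
        trace (Z t) * (\<Sum>I\<in>PiE S (\<lambda>_. UNIV). \<Prod>m\<in>S. Z m $ I m $ I (\<sigma> m))"
      unfolding sum_PiE_insert[OF insert.hyps]
      by (simp add: trace_def sum_product) (rule sum.swap)
    then show ?thesis using insert.prems insert.IH[OF \<sigma>S] by (auto intro: Cbar.mul Cbar.tr)
  next
    case False
    define s where "s = inv \<sigma> t"
    have st: "\<sigma> s = t" using permutes_inverses[OF \<sigma>] by (simp add: s_def)
    have "s \<noteq> t" using st False by auto
    moreover have "s \<in> insert t S" using st permutes_in_image[OF \<sigma>, of s] by simp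
    ultimately have s: "s \<in> S" "s \<noteq> t" by auto
    have \<sigma>t: "\<sigma> t \<in> S" using permutes_in_image[OF \<sigma>, of t] False by simp
    \<comment> \<open>The transposition bypasses \<open>t\<close>: now \<open>s\<close> is sent
      directly to \<open>\<sigma> t\<close>, and \<open>t\<close> is fixed.\<close>
    define \<tau> where "\<tau> = \<sigma> \<circ> Transposition.transpose s t"
    have \<tau>: "\<tau> s = \<sigma> t" "\<tau> t = t" "\<And>m. m \<noteq> s \<Longrightarrow> m \<noteq> t \<Longrightarrow> \<tau> m = \<sigma> m"
      using st by (auto simp: \<tau>_def Transposition.transpose_def)
    have "\<tau> permutes insert t S"
      unfolding \<tau>_def by (rule permutes_compose[OF permutes_swap_id \<sigma>]) (use s in auto)
    then have \<tau>S: "\<tau> permutes S"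
      by (rule permutes_superset) (use \<tau>(2) in auto)
    define Y where "Y = Z(s := Z s ** Z t)"
    have YR: "Y m \<in> Rgen A" if "m \<in> S" for m
      using that s insert.prems(2) by (auto simp: Y_def intro: Rgen.mul)
    have "(\<Sum>y\<in>UNIV. \<Prod>m\<in>insert t S. Z m $ (I(t := y)) m $ (I(t := y)) (\<sigma> m)) =
        (\<Prod>m\<in>S. Y m $ I m $ I (\<tau> m))" for I :: "'a \<Rightarrow> 'c"
    proof -
      define R where "R = (\<Prod>m\<in>S - {s}. Z m $ I m $ I (\<sigma> m))"
      have "(\<Prod>m\<in>insert t S. Z m $ (I(t := y)) m $ (I(t := y)) (\<sigma> m)) =
          Z s $ I s $ y * Z t $ y $ I (\<sigma> t) * R" for y
      proof -
        have "\<sigma> m \<noteq> t" if "m \<noteq> s" for m using that st permutes_inj[OF \<sigma>] by (metis injD)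
        then have "(\<Prod>m\<in>S - {s}. Z m $ (I(t := y)) m $ (I(t := y)) (\<sigma> m)) = R"
          unfolding R_def using insert.hyps by (intro prod.cong) auto
        moreover have "(\<Prod>m\<in>S. Z m $ (I(t := y)) m $ (I(t := y)) (\<sigma> m)) =
            Z s $ I s $ y * (\<Prod>m\<in>S - {s}. Z m $ (I(t := y)) m $ (I(t := y)) (\<sigma> m))"
          using insert.hyps s st by (subst prod.remove[of S s]) auto
        ultimately show ?thesis using insert.hyps False by (simp add: mult_ac)
      qed
      then have "(\<Sum>y\<in>UNIV. \<Prod>m\<in>insert t S. Z m $ (I(t := y)) m $ (I(t := y)) (\<sigma> m)) =
          (Z s ** Z t) $ I s $ I (\<sigma> t) * R"
        by (simp add: matrix_mult_nth sum_distrib_right)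
      also have "R = (\<Prod>m\<in>S - {s}. Y m $ I m $ I (\<tau> m))"
        unfolding R_def
      proof (rule prod.cong[OF refl])
        fix m assume "m \<in> S - {s}"
        then have "m \<noteq> s" "m \<noteq> t" using insert.hyps by auto
        then show "Z m $ I m $ I (\<sigma> m) = Y m $ I m $ I (\<tau> m)" by (simp add: Y_def \<tau>(3))
      qed
      also have "(Z s ** Z t) $ I s $ I (\<sigma> t) * \<dots> = (\<Prod>m\<in>S. Y m $ I m $ I (\<tau> m))"
        using insert.hyps s \<tau>(1) by (subst prod.remove[of S s]) (auto simp: Y_def)
      finally show ?thesis .
    qed
    then show ?thesis
      unfolding sum_PiE_insert[OF insert.hyps] using insert.IH[OF \<tau>S YR] by simp
  qed
qed

text \<open>Summing over \<open>J\<close> first merges each \<open>a i\<close> with a generic matrix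
  and leaves a contraction along the cycles of \<sigma>. The order of arguments in
  \<open>q J I\<close> makes this a trace pairing.\<close>

lemma tensor_span_contraction_in_Cbar:
  fixes A :: "('a::field_char_0^'n^'n) set" and \<alpha> :: "nat \<Rightarrow> 'k"
  assumes A: "unital_subalgebra A" and q: "q \<in> tensor_span A d"
  shows "(\<Sum>I\<in>multi_indices d. \<Sum>J\<in>multi_indices d. pconst (q J I) * (\<Prod>i<d. pvar (\<alpha> i, I i, J i))) \<in> Cbar A"
  using q
proof induction
  case zero
  show ?case by (simp add: Cbar_zero)
next
  case (step \<sigma> a f c)
  have "(\<Sum>I\<in>multi_indices d. \<Prod>i<d. (generic (\<alpha> i) ** cmat (a i)) $ I i $ I (\<sigma> i)) \<in> Cbar A"
    using step(1,2) by (intro cycle_contraction_in_Cbar) (auto intro: Rgen.intros)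
  moreover have "(\<Sum>J\<in>multi_indices d. pconst (tensor d \<sigma> a J I) * (\<Prod>i<d. pvar (\<alpha> i, I i, J i))) =
      (\<Prod>i<d. (generic (\<alpha> i) ** cmat (a i)) $ I i $ I (\<sigma> i))" for I
  proof -
    have "(\<Prod>i<d. (generic (\<alpha> i) ** cmat (a i)) $ I i $ I (\<sigma> i)) =
        (\<Prod>i<d. \<Sum>j\<in>UNIV. pconst (a i $ j $ I (\<sigma> i)) * pvar (\<alpha> i, I i, j))"
      by (simp add: matrix_mult_nth generic_def cmat_def mult.commute)
    then show ?thesis by (simp add: prod_sum_PiE prod.distrib tensor_def pconst_prod)
  qed
  ultimately have *: "(\<Sum>I\<in>multi_indices d. \<Sum>J\<in>multi_indices d. pconst (tensor d \<sigma> a J I) * (\<Prod>i<d. pvar (\<alpha> i, I i, J i))) \<in> Cbar A"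
    by simp
  have "(\<Sum>I\<in>multi_indices d. \<Sum>J\<in>multi_indices d.
        pconst (c * tensor d \<sigma> a J I + f J I) * (\<Prod>i<d. pvar (\<alpha> i, I i, J i))) =
      pconst c * (\<Sum>I\<in>multi_indices d. \<Sum>J\<in>multi_indices d. pconst (tensor d \<sigma> a J I) * (\<Prod>i<d. pvar (\<alpha> i, I i, J i))) +
      (\<Sum>I\<in>multi_indices d. \<Sum>J\<in>multi_indices d. pconst (f J I) * (\<Prod>i<d. pvar (\<alpha> i, I i, J i)))"
    by (simp add: pconst_add pconst_mult distrib_right sum.distrib sum_distrib_left mult.assoc)
  then show ?case using * step(4) by (auto intro!: Cbar.add Cbar.mul Cbar_pconst A)
qed

section \<open>Invariants as traces\<close>

text \<open>The exponent vector of the monomial with numbered factors \<open>x 0\<close>, ...,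
  \<open>x (d - 1)\<close>. The numbering lets monomials be indexed like tensors, at the price of an
  ambiguity by permutations.\<close>

definition word :: "nat \<Rightarrow> (nat \<Rightarrow> 'v) \<Rightarrow> ('v \<Rightarrow>\<^sub>0 nat)" where
  "word d x = (\<Sum>i<d. Poly_Mapping.single (x i) 1)"

lemma lookup_word: "Poly_Mapping.lookup (word d x) v = count (image_mset x (mset_set {..<d})) v"
  by (induction d) (auto simp: word_def lookup_add lookup_single lessThan_Suc when_def)

text \<open>Exponents are multiplicities, so equal words have the same multiset of letters.\<close>

lemma word_eqD:
  assumes "word d x = word d' y"
  obtains \<sigma> where "d = d'" "\<sigma> permutes {..<d}" "\<And>i. i < d \<Longrightarrow> x i = y (\<sigma> i)"
proof -
  have eq: "image_mset x (mset_set {..<d}) = image_mset y (mset_set {..<d'})"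
    using assms by (intro multiset_eqI) (simp flip: lookup_word)
  from arg_cong[OF this, of size] have "d = d'" by simp
  moreover from this eq obtain \<sigma> where "\<sigma> permutes {..<d}" "\<forall>i\<in>{..<d}. x i = y (\<sigma> i)"
    using image_mset_eq_implies_permutes[of "{..<d}" x y] by (metis finite_lessThan)
  ultimately show thesis using that by blast
qed

lemma word_permute:
  assumes "\<sigma> permutes {..<d}" shows "word d (\<lambda>i. x (\<sigma> i)) = word d x"
  unfolding word_def using sum.permute[OF assms, of "\<lambda>i. Poly_Mapping.single (x i) 1"]
  unfolding o_def by (rule sym)

lemma word_letter: "i < d \<Longrightarrow> x i \<in> Poly_Mapping.keys (word d x)"
  by (auto simp: in_keys_iff lookup_word)

lemma word_exists: obtains d x where "word d x = m"
proof -
  let ?w = "\<lambda>xs. \<Sum>v\<leftarrow>xs. Poly_Mapping.single v (1 :: nat)"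
  have "\<exists>xs. ?w xs = (\<Sum>v\<in>S. Poly_Mapping.single v (f v))" if "finite S" for S :: "'a set" and f
    using that
  proof (induction S rule: finite_induct)
    case empty
    show ?case by (intro exI[of _ "[]"]) simp
  next
    case (insert v S)
    then obtain xs where xs: "?w xs = (\<Sum>v\<in>S. Poly_Mapping.single v (f v))" by blast
    have "?w (replicate k v) = Poly_Mapping.single v k" for k
      by (induction k) (auto simp flip: single_add)
    then show ?case using xs insert.hyps
      by (intro exI[of _ "replicate (f v) v @ xs"]) simp
  qed
  from this[of "Poly_Mapping.keys m" "Poly_Mapping.lookup m"]
  obtain xs where "?w xs = m" by (auto simp flip: poly_mapping_expansion)
  then have "word (length xs) (\<lambda>i. xs ! i) = m"
    by (simp add: word_def sum_list_sum_nth atLeast0LessThan)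
  then show thesis by (rule that)
qed

lemma prod_pvar: "(\<Prod>i<d. pvar (x i)) = Poly_Mapping.single (word d x) 1"
  by (induction d) (auto simp: word_def pvar_def mult_single add.commute)

lemma pconst_mult_single: "pconst c * Poly_Mapping.single m b = Poly_Mapping.single m (c * b)"
  by (simp add: pconst_def mult_single)

lemma single_sum: "Poly_Mapping.single m (\<Sum>x\<in>S. f x) = (\<Sum>x\<in>S. Poly_Mapping.single m (f x))"
  by (induction S rule: infinite_finite_induct) (auto simp: single_add)

section \<open>The action on words and coefficient tensors\<close>

lemma gact_pvar:
  "gact g (pvar (\<alpha>, i, j)) = (\<Sum>k\<in>UNIV. \<Sum>l\<in>UNIV. pconst (g $ i $ k * matrix_inv g $ l $ j) * pvar (\<alpha>, k, l))"
  unfolding gact_def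
  by (simp add: matrix_mult_nth cmat_def generic_def pconst_mult sum_distrib_left sum_distrib_right mult_ac) (rule sum.swap)

lemma gact_word:
  "gact g (Poly_Mapping.single (word d (\<lambda>i. (\<alpha> i, I i, J i))) c) =
    (\<Sum>I'\<in>multi_indices d. \<Sum>J'\<in>multi_indices d. Poly_Mapping.single (word d (\<lambda>i. (\<alpha> i, I' i, J' i)))
      (c * tensor d id (\<lambda>_. g) I I' * tensor d id (\<lambda>_. matrix_inv g) J' J))"
proof -
  have "gact g (Poly_Mapping.single (word d (\<lambda>i. (\<alpha> i, I i, J i))) c) =
      gact g (pconst c * (\<Prod>i<d. pvar (\<alpha> i, I i, J i)))"
    by (simp add: prod_pvar pconst_mult_single)
  also have "\<dots> = pconst c * (\<Prod>i<d. gact g (pvar (\<alpha> i, I i, J i)))"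
    by (simp add: gact_def psubst_mult psubst_prod)
  also have "(\<Prod>i<d. gact g (pvar (\<alpha> i, I i, J i))) =
      (\<Sum>I'\<in>multi_indices d. \<Sum>J'\<in>multi_indices d.
        \<Prod>i<d. pconst (g $ I i $ I' i * matrix_inv g $ J' i $ J i) * pvar (\<alpha> i, I' i, J' i))"
    by (simp add: gact_pvar prod_sum_PiE)
  also have "\<dots> = (\<Sum>I'\<in>multi_indices d. \<Sum>J'\<in>multi_indices d. Poly_Mapping.single (word d (\<lambda>i. (\<alpha> i, I' i, J' i)))
      (tensor d id (\<lambda>_. g) I I' * tensor d id (\<lambda>_. matrix_inv g) J' J))"
    by (simp add: prod.distrib prod_pvar pconst_mult_single tensor_def flip: pconst_prod)
  finally show ?thesis
    by (simp add: sum_distrib_left pconst_mult_single mult.assoc)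
qed

lemma bij_betw_reindex_multi_indices:
  assumes \<sigma>: "\<sigma> permutes {..<d}"
  shows "bij_betw (\<lambda>I i. I (\<sigma> i)) (multi_indices d :: (nat \<Rightarrow> 'n) set) (multi_indices d)"
proof (rule bij_betw_byWitness[where f' = "\<lambda>I i. I (inv \<sigma> i)"])
  have "(\<lambda>i. I (\<rho> i)) \<in> multi_indices d" if "\<rho> permutes {..<d}" "I \<in> multi_indices d" for \<rho> and I :: "nat \<Rightarrow> 'n"
    using that permutes_not_in[OF that(1)] by (auto simp: PiE_iff extensional_def)
  then show "(\<lambda>I i. I (\<sigma> i)) ` (multi_indices d :: (nat \<Rightarrow> 'n) set) \<subseteq> multi_indices d"
    "(\<lambda>I i. I (inv \<sigma> i)) ` (multi_indices d :: (nat \<Rightarrow> 'n) set) \<subseteq> multi_indices d"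
    using \<sigma> permutes_inv[OF \<sigma>] by (simp_all add: image_subset_iff)
qed (use permutes_inverses[OF \<sigma>] in auto)

text \<open>With \<open>G\<close> and \<open>H\<close> the tensor powers of \<open>g\<close> and
  \<open>h\<close>, the hypothesis reads \<open>T = H T G\<close>. Multiplication by
  \<open>G\<close> from the left gives \<open>G T = T G\<close>, since \<open>G H\<close> is the
  identity.\<close>

lemma conjugation_commutes:
  fixes T :: "(nat \<Rightarrow> 'n::finite) \<Rightarrow> (nat \<Rightarrow> 'n) \<Rightarrow> 'a::comm_ring_1"
  assumes gh: "g ** h = mat 1"
    and T: "\<And>I J. I \<in> multi_indices d \<Longrightarrow> J \<in> multi_indices d \<Longrightarrow> T J I =
      (\<Sum>I'\<in>multi_indices d. \<Sum>J'\<in>multi_indices d. T J' I' * tensor d id (\<lambda>_. g) I' I * tensor d id (\<lambda>_. h) J J')"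
  shows "commutes_with d T (tensor d id (\<lambda>_. g))"
  unfolding commutes_with_def
proof (intro ballI)
  let ?N = "multi_indices d :: (nat \<Rightarrow> 'n) set" and ?G = "tensor d id (\<lambda>_. g)" and ?H = "tensor d id (\<lambda>_. h)"
  fix Q R assume QR: "Q \<in> ?N" "R \<in> ?N"
  have GH: "(\<Sum>M\<in>?N. ?G Q M * ?H M J) = (if Q = J then 1 else 0)" if "J \<in> ?N" for J
    using tensor_mult[of id d "\<lambda>_. g" Q id "\<lambda>_. h" J] tensor_one[OF QR(1) that] by (simp add: gh)
  have "(\<Sum>M\<in>?N. ?G Q M * T M R) = (\<Sum>M\<in>?N. \<Sum>I\<in>?N. \<Sum>J\<in>?N. T J I * ?G I R * (?G Q M * ?H M J))"
    using T[OF QR(2)] by (simp add: sum_distrib_left mult_ac)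
  also have "\<dots> = (\<Sum>I\<in>?N. \<Sum>J\<in>?N. T J I * ?G I R * (\<Sum>M\<in>?N. ?G Q M * ?H M J))"
    unfolding sum_distrib_left by (subst sum.swap, rule sum.cong[OF refl], rule sum.swap)
  also have "\<dots> = (\<Sum>I\<in>?N. \<Sum>J\<in>?N. if Q = J then T J I * ?G I R else 0)"
    using GH by (intro sum.cong) auto
  also have "\<dots> = (\<Sum>I\<in>?N. T Q I * ?G I R)" using QR(1) by simp
  finally show "(\<Sum>M\<in>?N. T Q M * ?G M R) = (\<Sum>M\<in>?N. ?G Q M * T M R)" by simp
qed

text \<open>An invariant \<open>p\<close> is written with the symmetric coefficient tensor \<open>t\<close>, which is unique in
  characteristic zero. The invariance of \<open>p\<close> is thereby inherited by \<open>t\<close>.\<close>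
lemma invariants_subset_Cbar:
  fixes A :: "('a::field_char_0^'n^'n) set"
  assumes A: "unital_subalgebra A" and ss: "semisimple_alg A"
  shows "(invariants (centralizer_units A) :: ('k \<times> 'n \<times> 'n, 'a) mpoly set) \<subseteq> Cbar A"
proof
  fix p :: "('k \<times> 'n \<times> 'n, 'a) mpoly"
  assume p: "p \<in> invariants (centralizer_units A)"
  let ?N = "\<lambda>d. multi_indices d :: (nat \<Rightarrow> 'n) set"
  define K where "K = fst ` (\<Union>m\<in>Poly_Mapping.keys p. Poly_Mapping.keys m)"
  define V where "V d = PiE {..<d} (\<lambda>_. K)" for d :: nat
  have finV: "finite (V d)" for d unfolding V_def K_def by (intro finite_PiE) auto
  define x :: "(nat \<Rightarrow> 'k) \<times> (nat \<Rightarrow> 'n) \<times> (nat \<Rightarrow> 'n) \<Rightarrow> nat \<Rightarrow> 'k \<times> 'n \<times> 'n"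
    where "x = (\<lambda>(\<alpha>, I, J) i. (\<alpha> i, I i, J i))"
  define W where "W d = V d \<times> ?N d \<times> ?N d" for d
  have finW: "finite (W d)" for d using finV by (simp add: W_def)
  have "\<forall>m. \<exists>d. \<exists>y. word d y = m" using word_exists by metis
  then obtain deg :: "('k \<times> 'n \<times> 'n \<Rightarrow>\<^sub>0 nat) \<Rightarrow> nat" where deg: "\<And>m. \<exists>y. word (deg m) y = m" by metis
  define \<Delta> where "\<Delta> = deg ` Poly_Mapping.keys p"
  have fin\<Delta>: "finite \<Delta>" by (simp add: \<Delta>_def)
  define cnt where "cnt d m = card {w \<in> W d. word d (x w) = m}" for d m
  have cnt_pos: "cnt d (word d (x w)) > 0" if "w \<in> W d" for d w
  proof -
    have "w \<in> {w' \<in> W d. word d (x w') = word d (x w)}" using that by simp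
    moreover have "finite {w' \<in> W d. word d (x w') = word d (x w)}" using finW by simp
    ultimately show ?thesis unfolding cnt_def card_gt_0_iff by blast
  qed
  define F where "F s = (\<Sum>d\<in>\<Delta>. \<Sum>w\<in>W d. Poly_Mapping.single (word d (x w)) (s d w))" for s :: "nat \<Rightarrow> _ \<Rightarrow> 'a"
  \<comment> \<open>A tensor that is constant on the index triples naming one monomial can be read
    off from its polynomial; this is the uniqueness of the symmetric tensor. Words of different
    lengths never name the same monomial.\<close>
  have coeff: "Poly_Mapping.lookup (F s) (word d (x w)) = of_nat (cnt d (word d (x w))) * s d w"
    if d: "d \<in> \<Delta>" and s: "\<And>w'. w' \<in> W d \<Longrightarrow> word d (x w') = word d (x w) \<Longrightarrow> s d w' = s d w" for s d w
  proof -
    have "(\<Sum>w'\<in>W e. s e w' when word e (x w') = word d (x w)) =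
        (if e = d then of_nat (cnt d (word d (x w))) * s d w else 0)" if "e \<in> \<Delta>" for e
    proof (cases "e = d")
      case True
      have "(\<Sum>w'\<in>W d. s d w' when word d (x w') = word d (x w)) =
          (\<Sum>w' | w' \<in> W d \<and> word d (x w') = word d (x w). s d w')"
        using finW by (simp add: when_def sum.inter_filter)
      also have "\<dots> = (\<Sum>w' | w' \<in> W d \<and> word d (x w') = word d (x w). s d w)"
        using s by (intro sum.cong) auto
      finally show ?thesis using True by (simp add: cnt_def)
    next
      case False
      then have "word e (x w') \<noteq> word d (x w)" for w' by (metis word_eqD)
      then show ?thesis using False by simp
    qed
    then show ?thesis using d fin\<Delta> by (simp add: F_def lookup_sum lookup_single)
  qed
  \<comment> \<open>Each coefficient of \<open>p\<close> is shared equally among the triples naming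
    its monomial; their number is invertible in characteristic zero.\<close>
  define t where "t d w = Poly_Mapping.lookup p (word d (x w)) / of_nat (cnt d (word d (x w)))" for d w
  have t_sym: "t d w = t d w'" if "word d (x w) = word d (x w')" for d w w'
    using that by (simp add: t_def)
  have Ft: "F t = p"
  proof (rule poly_mapping_eqI)
    fix m
    show "Poly_Mapping.lookup (F t) m = Poly_Mapping.lookup p m"
    proof (cases "m \<in> Poly_Mapping.keys p")
      case True
      obtain y where y: "word (deg m) y = m" using deg by blast
      define w where "w = (restrict (\<lambda>i. fst (y i)) {..<deg m}, restrict (\<lambda>i. fst (snd (y i))) {..<deg m},
        restrict (\<lambda>i. snd (snd (y i))) {..<deg m})"
      have "word (deg m) (x w) = word (deg m) y"
        unfolding word_def by (intro sum.cong) (auto simp: x_def w_def)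
      then have wm: "word (deg m) (x w) = m" using y by simp
      have "fst (y i) \<in> K" if "i < deg m" for i
        using word_letter[OF that, of y] y True by (auto simp: K_def)
      then have w: "w \<in> W (deg m)" by (auto simp: w_def W_def V_def)
      have "Poly_Mapping.lookup (F t) (word (deg m) (x w)) = of_nat (cnt (deg m) m) * t (deg m) w"
        using True t_sym by (subst coeff) (auto simp: \<Delta>_def wm)
      then show ?thesis using cnt_pos[OF w] by (simp add: t_def wm)
    next
      case False
      then have "Poly_Mapping.lookup p m = 0" by (simp add: in_keys_iff)
      then show ?thesis
        by (auto simp: F_def lookup_sum lookup_single t_def when_def intro!: sum.neutral)
    qed
  qed
  have t_inv: "t d (\<alpha>, I, J) = (\<Sum>I'\<in>?N d. \<Sum>J'\<in>?N d. t d (\<alpha>, I', J') * tensor d id (\<lambda>_. g) I' I *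
      tensor d id (\<lambda>_. matrix_inv g) J J')"
    if g: "g \<in> centralizer_units A" and d: "d \<in> \<Delta>" and w: "(\<alpha>, I, J) \<in> W d" for g d \<alpha> I J
  proof -
    let ?G = "\<lambda>d. tensor d id (\<lambda>_. g)" and ?H = "\<lambda>d. tensor d id (\<lambda>_. matrix_inv g)"
    \<comment> \<open>The coefficient tensor of \<open>gact g p\<close>. It is again symmetric and
      belongs to the same polynomial \<open>p\<close>, so it equals \<open>t\<close>.\<close>
    define t' where "t' = (\<lambda>d (\<alpha>, I, J). \<Sum>I'\<in>?N d. \<Sum>J'\<in>?N d. t d (\<alpha>, I', J') * ?G d I' I * ?H d J J')"
    have t'_sym: "t' d (\<beta>, I1, J1) = t' d (\<alpha>, I, J)"
      if eq: "word d (x (\<beta>, I1, J1)) = word d (x (\<alpha>, I, J))" for \<beta> I1 J1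
    proof -
      obtain \<sigma> where \<sigma>: "\<sigma> permutes {..<d}" and "\<And>i. i < d \<Longrightarrow> x (\<beta>, I1, J1) i = x (\<alpha>, I, J) (\<sigma> i)"
        using word_eqD[OF eq] by metis
      then have \<sigma>': "\<And>i. i < d \<Longrightarrow> \<beta> i = \<alpha> (\<sigma> i)" "\<And>i. i < d \<Longrightarrow> I1 i = I (\<sigma> i)" "\<And>i. i < d \<Longrightarrow> J1 i = J (\<sigma> i)"
        by (auto simp: x_def)
      have G: "?G d (\<lambda>i. I' (\<sigma> i)) I1 = ?G d I' I" for I'
        using prod.permute[OF \<sigma>, of "\<lambda>i. g $ I' i $ I i"] by (simp add: tensor_def \<sigma>' o_def)
      have H: "?H d J1 (\<lambda>i. J' (\<sigma> i)) = ?H d J J'" for J'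
        using prod.permute[OF \<sigma>, of "\<lambda>i. matrix_inv g $ J i $ J' i"] by (simp add: tensor_def \<sigma>' o_def)
      have t: "t d (\<beta>, (\<lambda>i. I' (\<sigma> i)), (\<lambda>i. J' (\<sigma> i))) = t d (\<alpha>, I', J')" for I' J'
      proof (rule t_sym)
        have "word d (x (\<beta>, (\<lambda>i. I' (\<sigma> i)), (\<lambda>i. J' (\<sigma> i)))) = word d (\<lambda>i. x (\<alpha>, I', J') (\<sigma> i))"
          unfolding word_def by (intro sum.cong) (auto simp: x_def \<sigma>')
        also have "\<dots> = word d (x (\<alpha>, I', J'))" by (rule word_permute[OF \<sigma>])
        finally show "word d (x (\<beta>, (\<lambda>i. I' (\<sigma> i)), (\<lambda>i. J' (\<sigma> i)))) = word d (x (\<alpha>, I', J'))" .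
      qed
      note re = sum.reindex_bij_betw[OF bij_betw_reindex_multi_indices[OF \<sigma>], symmetric]
      have "t' d (\<beta>, I1, J1) = (\<Sum>I'\<in>?N d. \<Sum>J'\<in>?N d. t d (\<beta>, (\<lambda>i. I' (\<sigma> i)), (\<lambda>i. J' (\<sigma> i))) *
          ?G d (\<lambda>i. I' (\<sigma> i)) I1 * ?H d J1 (\<lambda>i. J' (\<sigma> i)))"
        unfolding t'_def prod.case by (subst re, rule sum.cong[OF refl], rule re)
      also have "\<dots> = t' d (\<alpha>, I, J)" unfolding G H t by (simp add: t'_def)
      finally show ?thesis .
    qed
    have F_nested: "F s = (\<Sum>d\<in>\<Delta>. \<Sum>\<alpha>\<in>V d. \<Sum>I\<in>?N d. \<Sum>J\<in>?N d.
        Poly_Mapping.single (word d (\<lambda>i. (\<alpha> i, I i, J i))) (s d (\<alpha>, I, J)))" for s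
      by (simp add: F_def W_def sum.cartesian_product' x_def)
    have "p = gact g (F t)" using p g by (simp add: invariants_def Ft)
    also have "\<dots> = (\<Sum>d\<in>\<Delta>. \<Sum>\<alpha>\<in>V d. \<Sum>I\<in>?N d. \<Sum>J\<in>?N d. \<Sum>I'\<in>?N d. \<Sum>J'\<in>?N d.
        Poly_Mapping.single (word d (\<lambda>i. (\<alpha> i, I' i, J' i))) (t d (\<alpha>, I, J) * ?G d I I' * ?H d J' J))"
      unfolding F_nested gact_def psubst_sum unfolding gact_def[symmetric] gact_word ..
    also have "\<dots> = F t'"
    proof -
      have swap: "(\<Sum>I\<in>N. \<Sum>J\<in>N. \<Sum>I'\<in>N. \<Sum>J'\<in>N. f I J I' J') = (\<Sum>I'\<in>N. \<Sum>J'\<in>N. \<Sum>I\<in>N. \<Sum>J\<in>N. f I J I' J')"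
        for N :: "(nat \<Rightarrow> 'n) set" and f :: "_ \<Rightarrow> _ \<Rightarrow> _ \<Rightarrow> _ \<Rightarrow> ('k \<times> 'n \<times> 'n, 'a) mpoly"
        using sum.swap[of "\<lambda>(I, J) (I', J'). f I J I' J'" "N \<times> N" "N \<times> N"]
        by (simp add: sum.cartesian_product')
      show ?thesis
        unfolding F_nested t'_def prod.case single_sum
        by (intro sum.cong refl swap)
    qed
    finally have pF: "p = F t'" .
    have "of_nat (cnt d (word d (x (\<alpha>, I, J)))) * t' d (\<alpha>, I, J) =
        Poly_Mapping.lookup (F t') (word d (x (\<alpha>, I, J)))"
    proof (rule coeff[OF d, symmetric])
      fix w' assume "word d (x w') = word d (x (\<alpha>, I, J))"
      then show "t' d w' = t' d (\<alpha>, I, J)"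
        by (cases w', hypsubst, intro t'_sym)
    qed
    also have "\<dots> = Poly_Mapping.lookup (F t) (word d (x (\<alpha>, I, J)))"
      by (simp only: Ft flip: pF)
    also have "\<dots> = of_nat (cnt d (word d (x (\<alpha>, I, J)))) * t d (\<alpha>, I, J)"
      by (rule coeff[OF d]) (rule t_sym)
    finally have "t' d (\<alpha>, I, J) = t d (\<alpha>, I, J)" using cnt_pos[OF w] by simp
    then show ?thesis by (simp add: t'_def)
  qed
  have "(\<Sum>I\<in>?N d. \<Sum>J\<in>?N d. pconst (t d (\<alpha>, I, J)) * (\<Prod>i<d. pvar (\<alpha> i, I i, J i))) \<in> Cbar A"
    if d: "d \<in> \<Delta>" and \<alpha>: "\<alpha> \<in> V d" for d \<alpha>
  proof -
    \<comment> \<open>The second subscripts become the rows: this gives \<open>t_inv\<close> the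
      form \<open>T = H T G\<close> and matches the trace pairing of the contraction.\<close>
    have comm: "commutes_with d (\<lambda>J I. t d (\<alpha>, I, J)) (tensor d id (\<lambda>_. g))" if g: "g \<in> centralizer_units A" for g
    proof (rule conjugation_commutes)
      show "g ** matrix_inv g = mat 1"
        using g by (auto simp: centralizer_units_def invertible_matrix_inv)
      show "t d (\<alpha>, I, J) = (\<Sum>I'\<in>?N d. \<Sum>J'\<in>?N d. t d (\<alpha>, I', J') * tensor d id (\<lambda>_. g) I' I *
        tensor d id (\<lambda>_. matrix_inv g) J J')" if "I \<in> ?N d" "J \<in> ?N d" for I J
        by (rule t_inv[OF g d]) (use that \<alpha> in \<open>simp add: W_def\<close>)
    qed
    obtain q where q: "q \<in> tensor_span A d"
      "\<And>J I. J \<in> ?N d \<Longrightarrow> I \<in> ?N d \<Longrightarrow> t d (\<alpha>, I, J) = q J I"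
      by (rule tensor_double_centralizer[OF A ss comm]) blast+
    then show ?thesis using tensor_span_contraction_in_Cbar[OF A q(1), of \<alpha>] by simp
  qed
  then have "F t \<in> Cbar A"
    by (simp add: F_def W_def sum.cartesian_product' x_def prod_pvar pconst_mult_single Cbar_sum)
  then show "p \<in> Cbar A" by (simp add: Ft)
qed

theorem theorem5p4:
  fixes A :: "('a::field_char_0 ^ 'n ^ 'n) set"
  assumes "unital_subalgebra A"
    and "semisimple_alg A"
  shows "(invariants (centralizer_units A) :: (('k \<times> 'n \<times> 'n), 'a) mpoly set) = Cbar A"
  using invariants_subset_Cbar[OF assms] Cbar_subset_invariants by (rule equalityI)

end
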